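(* Let $\alpha>0$ and let $X=(X_t)_{t\in\mathbb{R}}$ be a two-sided real-valued Lévy process which is not a deterministic linear drift and which satisfies $\mathbb{E}[|X_1|]<\infty$ and $|\mathbb{E}[X_1]|<\alpha$. Let $M$ be the $\alpha$-Lipschitz minorant of $X$ and suppose that the contact set $\mathcal{Z}=\{t\in\mathbb{R}:M_t=X_t\wedge X_{t-}\}$ is almost surely discrete. Let $G=\sup(\mathcal{Z}\cap(-\infty,0))$ and $D=\inf(\mathcal{Z}\cap(0,\infty))$. Then the random variable $U_0=\frac{-G}{D-G}$ is uniformly distributed on $[0,1)$ and independent of the process $(X_{t+D}-X_D)_{t\in\mathbb{R}}$. In particular, $\frac{D}{D-G}$ is uniformly distributed on $[0,1]$ and independent of the straddling excursion $(X_t-X_G,\ G\le t<D)$ (viewed as the path $s\mapsto X_{G+s}-X_G$, $0\le s<D-G$, with lifetime $D-G$).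
   Context: A two-sided Lévy process is a real-valued process indexed by $\mathbb{R}$ with càdlàg paths, stationary independent increments and value $0$ at time $0$. "Not a deterministic linear drift" means that there is no $a\in\mathbb{R}$ with $X_t=at$ for all $t$. The conditions $\mathbb{E}[|X_1|]<\infty$, $|\mathbb{E}[X_1]|<\alpha$ ensure that almost surely the path of $X$ has an $\alpha$-Lipschitz minorant $M$, the greatest function with $M\le X$ and $|M_s-M_t|\le\alpha|s-t|$ for all $s,t$; explicitly $M_t=\inf\{X_s+\alpha|t-s|:s\in\mathbb{R}\}$. The random set $\mathcal{Z}$ is a.s. closed and stationary. *)

theory Defs
  imports "HOL-Probability.Probability"
begin

text \<open>The library's \<open>indep_var\<close> requires both random variables to have the same value type; this is the
  same notion, in the form of \<open>indep_var_eq\<close>, for two value types.\<close>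

definition (in prob_space) indep_rvs ::
  "'b measure \<Rightarrow> ('a \<Rightarrow> 'b) \<Rightarrow> 'c measure \<Rightarrow> ('a \<Rightarrow> 'c) \<Rightarrow> bool" where
  "indep_rvs S U T V \<longleftrightarrow>
    random_variable S U \<and> random_variable T V \<and>
    indep_set (sigma_sets (space M) {U -` A \<inter> space M | A. A \<in> sets S})
      (sigma_sets (space M) {V -` A \<inter> space M | A. A \<in> sets T})"

lemma (in prob_space) indep_rvs_iff_indep_var: "indep_rvs S U T V \<longleftrightarrow> indep_var S U T V"
  unfolding indep_rvs_def indep_var_eq by blast

definition cadlag :: "(real \<Rightarrow> real) \<Rightarrow> bool" where
  "cadlag f \<longleftrightarrow> (\<forall>t. continuous (at_right t) f \<and> (\<exists>l. (f \<longlongrightarrow> l) (at_left t)))"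

locale two_sided_levy = prob_space P for P :: "'a measure" +
  fixes X :: "real \<Rightarrow> 'a \<Rightarrow> real"
  assumes random_variable_X: "\<And>t. random_variable borel (X t)"
    and cadlag_paths: "\<And>\<omega>. \<omega> \<in> space P \<Longrightarrow> cadlag (\<lambda>t. X t \<omega>)"
    and X_zero: "\<And>\<omega>. \<omega> \<in> space P \<Longrightarrow> X 0 \<omega> = 0"
    and stationary_increments:
      "\<And>s t h. s \<le> t \<Longrightarrow>
        distr P borel (\<lambda>\<omega>. X (t + h) \<omega> - X (s + h) \<omega>) = distr P borel (\<lambda>\<omega>. X t \<omega> - X s \<omega>)"
    and independent_increments:
      "\<And>(t :: nat \<Rightarrow> real) n. strict_mono_on {..n} t \<Longrightarrow>
        indep_vars (\<lambda>_. borel) (\<lambda>i \<omega>. X (t (Suc i)) \<omega> - X (t i) \<omega>) {..<n}"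

text \<open>The infimum is taken in the extended reals: a path without an \<open>\<alpha>\<close>-Lipschitz minorant gets
  the value \<open>-\<infinity>\<close> everywhere (and hence an empty contact set below), and for every
  other path the infimum is the greatest \<open>\<alpha>\<close>-Lipschitz function below the path, as shown in
  \<open>lipschitz_minorant_greatest\<close>.\<close>

definition lipschitz_minorant :: "real \<Rightarrow> (real \<Rightarrow> real) \<Rightarrow> real \<Rightarrow> ereal" where
  "lipschitz_minorant \<alpha> f t = (INF s. ereal (f s + \<alpha> * \<bar>t - s\<bar>))"

lemma lipschitz_minorant_greatest:
  assumes "\<alpha> \<ge> 0" and "\<alpha>-lipschitz_on UNIV g" and "\<And>t. g t \<le> f t"
  obtains m where "\<And>t. lipschitz_minorant \<alpha> f t = ereal (m t)"
    and "\<alpha>-lipschitz_on UNIV m" and "\<And>t. m t \<le> f t"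
    and "\<And>h t. \<alpha>-lipschitz_on UNIV h \<Longrightarrow> (\<And>t. h t \<le> f t) \<Longrightarrow> h t \<le> m t"
proof -
  have below: "ereal (h t) \<le> lipschitz_minorant \<alpha> f t"
    if "\<alpha>-lipschitz_on UNIV h" "\<And>t. h t \<le> f t" for h t
    unfolding lipschitz_minorant_def
  proof (rule INF_greatest)
    fix s
    have "h t - h s \<le> \<alpha> * \<bar>t - s\<bar>"
      using lipschitz_onD[OF that(1), of t s] by (simp add: dist_real_def)
    with that(2)[of s] show "ereal (h t) \<le> ereal (f s + \<alpha> * \<bar>t - s\<bar>)" by simp
  qed
  have above: "lipschitz_minorant \<alpha> f t \<le> ereal (f s + \<alpha> * \<bar>t - s\<bar>)" for s t
    unfolding lipschitz_minorant_def by (rule INF_lower) simp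
  define m where "m t = real_of_ereal (lipschitz_minorant \<alpha> f t)" for t
  have m: "lipschitz_minorant \<alpha> f t = ereal (m t)" for t
    using below[OF assms(2,3), of t] above[of t t]
    by (cases "lipschitz_minorant \<alpha> f t") (auto simp: m_def)
  have step: "m t \<le> m s + \<alpha> * \<bar>t - s\<bar>" for s t
  proof -
    have "ereal (m t - \<alpha> * \<bar>t - s\<bar>) \<le> lipschitz_minorant \<alpha> f s"
      unfolding lipschitz_minorant_def
    proof (rule INF_greatest)
      fix r
      have "m t \<le> f r + \<alpha> * \<bar>t - r\<bar>" using above[of t r] m by simp
      also have "\<alpha> * \<bar>t - r\<bar> \<le> \<alpha> * (\<bar>t - s\<bar> + \<bar>s - r\<bar>)"
        by (rule mult_left_mono) (use assms in auto)
      finally show "ereal (m t - \<alpha> * \<bar>t - s\<bar>) \<le> ereal (f r + \<alpha> * \<bar>s - r\<bar>)"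
        by (simp add: algebra_simps)
    qed
    then show ?thesis using m[of s] by simp
  qed
  show ?thesis
  proof (rule that[of m])
    show "lipschitz_minorant \<alpha> f t = ereal (m t)" for t by (rule m)
    show "\<alpha>-lipschitz_on UNIV m"
    proof (rule lipschitz_onI)
      show "dist (m x) (m y) \<le> \<alpha> * dist x y" for x y
        using step[of x y] step[of y x] by (simp add: dist_real_def abs_minus_commute)
    qed (use assms in auto)
    show "m t \<le> f t" for t using above[of t t] m by simp
    show "h t \<le> m t" if "\<alpha>-lipschitz_on UNIV h" "\<And>t. h t \<le> f t" for h t
      using below[OF that] m by simp
  qed
qed

definition contact_set :: "real \<Rightarrow> (real \<Rightarrow> real) \<Rightarrow> real set" where
  "contact_set \<alpha> f = {t. lipschitz_minorant \<alpha> f t = ereal (min (f t) (Lim (at_left t) f))}"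

text \<open>A path with a finite lifetime is represented by the pair of its lifetime and of the path
  itself, set to \<open>0\<close> outside of \<open>[0, lifetime)\<close>.\<close>

definition excursion :: "(real \<Rightarrow> real) \<Rightarrow> real \<Rightarrow> real \<Rightarrow> real \<times> (real \<Rightarrow> real)" where
  "excursion f g d = (d - g, \<lambda>s. if 0 \<le> s \<and> s < d - g then f (g + s) - f g else 0)"

end

theory Submission
  imports Defs
begin

text \<open>
  The statement is a fact about stationarity: the increments of \<open>X\<close> are stationary, so for every
  \<open>r\<close> the recentred path \<open>t \<mapsto> X (t + r) - X r\<close> has the law of \<open>X\<close>
  (\<open>sample_path_stationary\<close>), and its contact set is the contact set of \<open>X\<close> translated by \<open>-r\<close>
  (\<open>contact_set_recentre\<close>). Seen from the origin, the origin is therefore a typical point of the gap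
  \<open>(G, D)\<close> of the contact set in which it lies, that is, a uniform one, whatever the shape of the
  path as seen from an end point of the gap.

  The precise form of this is a mass transport argument (\<open>gap_mass_transport\<close>). For \<open>h \<ge> 0\<close> on
  paths, let every point \<open>s\<close> of the line spread the mass \<open>h\<close> of the path recentred at \<open>s\<close> uniformly
  over the gap of \<open>s\<close>. By Tonelli and stationarity, the expected mass sent out by the origin, \<open>E h\<close>,
  is the expected mass that the origin receives, which is the expectation of the average over
  \<open>r \<in> (G, D)\<close> of \<open>h\<close> evaluated at the path recentred at \<open>r\<close>. Take for \<open>h\<close> the product of the
  indicators of \<open>-G / (D - G) \<in> A\<close> and \<open>\<Psi> \<in> B\<close>, where \<open>\<Psi>\<close> does not change when the path is
  recentred within the gap. Then the average is the Lebesgue measure of \<open>A \<inter> (0, 1)\<close> times the indicator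
  of \<open>\<Psi> \<in> B\<close> (\<open>gap_fraction_uniform\<close>): uniformity and independence at once. The path recentred at
  \<open>D\<close> and the straddling excursion are two such \<open>\<Psi>\<close>, and \<open>D / (D - G) = 1 - (-G) / (D - G)\<close>.

  The argument needs that the contact set is almost surely unbounded in both directions and does not
  contain the origin. The second is again stationarity, as a discrete set of reals is countable and so
  has Lebesgue measure \<open>0\<close>.
  For the first, stationarity reduces unboundedness to non-emptiness (\<open>contact_set_unbounded_AE\<close>),
  and the contact set of a path \<open>f\<close> contains the place where \<open>f s + \<alpha> * \<bar>s\<bar>\<close> attains its infimum,
  so it is non-empty as soon as \<open>f s + \<beta> * \<bar>s\<bar>\<close> is bounded below for some \<open>\<beta> < \<alpha>\<close>
  (\<open>contact_set_nonempty\<close>). With \<open>\<beta>\<close> strictly between \<open>\<bar>E X\<^sub>1\<bar>\<close> and \<open>\<alpha>\<close>, this says that two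
  processes with positive drift, one for each direction of time, are bounded below. At integer times
  they are random walks, for which Lindley's recursion gives the bound
  (\<open>random_walk_bounded_below\<close>), and a maximal inequality of Ottaviani type carries it over to all
  times (\<open>ottaviani_grid\<close>).
\<close>

section \<open>The contact set of a single path\<close>

definition min_left_limit :: "(real \<Rightarrow> real) \<Rightarrow> real \<Rightarrow> real" where
  "min_left_limit f t = min (f t) (Lim (at_left t) f)"

lemma cadlag_tendsto_right: "cadlag f \<Longrightarrow> (f \<longlongrightarrow> f t) (at_right t)"
  by (simp add: cadlag_def continuous_within)

lemma cadlag_tendsto_left: "cadlag f \<Longrightarrow> (f \<longlongrightarrow> Lim (at_left t) f) (at_left t)"
  unfolding cadlag_def by (metis tendsto_Lim trivial_limit_at_left_real)

text \<open>Lower semicontinuity of \<open>X\<^sub>t \<and> X\<^sub>t\<^sub>-\<close>, in terms of the path itself.\<close>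

lemma eventually_gt_min_left_limit:
  assumes "cadlag f" "x < min_left_limit f t"
  shows "eventually (\<lambda>s. x < f s) (nhds t)"
proof -
  have "eventually (\<lambda>s. x < f s) (at_left t)" "eventually (\<lambda>s. x < f s) (at_right t)" "x < f t"
    using order_tendstoD(1)[OF cadlag_tendsto_left[OF assms(1)], of x t]
      order_tendstoD(1)[OF cadlag_tendsto_right[OF assms(1)], of x t] assms(2)
    by (auto simp: min_left_limit_def)
  then show ?thesis unfolding eventually_nhds_conv_at eventually_at_split by blast
qed

lemma min_left_limit_less_approx:
  assumes "cadlag f" "min_left_limit f t < x" "0 < e"
  obtains q where "q \<in> \<rat>" "\<bar>q - t\<bar> < e" "f q < x"
proof (cases "f t < x")
  case True
  with order_tendstoD(2)[OF cadlag_tendsto_right[OF assms(1)], of t x]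
  obtain b where "t < b" "\<And>y. t < y \<Longrightarrow> y < b \<Longrightarrow> f y < x"
    by (auto simp: eventually_at_right_field)
  moreover obtain q where "q \<in> \<rat>" "t < q" "q < min b (t + e)"
    using Rats_dense_in_real[of t "min b (t + e)"] \<open>t < b\<close> \<open>0 < e\<close> by auto
  ultimately show ?thesis by (intro that[of q]) auto
next
  case False
  with assms(2) have "Lim (at_left t) f < x" by (auto simp: min_left_limit_def)
  with order_tendstoD(2)[OF cadlag_tendsto_left[OF assms(1)], of t x]
  obtain b where "b < t" "\<And>y. b < y \<Longrightarrow> y < t \<Longrightarrow> f y < x"
    by (auto simp: eventually_at_left_field)
  moreover obtain q where "q \<in> \<rat>" "max b (t - e) < q" "q < t"
    using Rats_dense_in_real[of "max b (t - e)" t] \<open>b < t\<close> \<open>0 < e\<close> by auto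
  ultimately show ?thesis by (intro that[of q]) auto
qed

lemma le_min_left_limitI:
  assumes "cadlag f" "0 < e" "\<And>q. q \<in> \<rat> \<Longrightarrow> \<bar>q - t\<bar> < e \<Longrightarrow> x \<le> f q"
  shows "x \<le> min_left_limit f t"
proof (rule ccontr)
  assume "\<not> x \<le> min_left_limit f t"
  then obtain q where "q \<in> \<rat>" "\<bar>q - t\<bar> < e" "f q < x"
    using min_left_limit_less_approx[OF assms(1) _ assms(2), of t x] by (metis not_le)
  with assms(3)[of q] show False by simp
qed

text \<open>The minorant never exceeds \<open>min_left_limit f\<close>, because it is continuous and lies below \<open>f\<close>. So
  contact at \<open>t\<close> amounts to a family of inequalities between reals, and the extended reals disappear
  from all that follows.\<close>

lemma contact_set_iff:
  assumes "0 < \<alpha>" "cadlag f"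
  shows "t \<in> contact_set \<alpha> f \<longleftrightarrow> (\<forall>s. min_left_limit f t \<le> f s + \<alpha> * \<bar>t - s\<bar>)"
proof
  assume "t \<in> contact_set \<alpha> f"
  then have eq: "lipschitz_minorant \<alpha> f t = ereal (min_left_limit f t)"
    by (simp add: contact_set_def min_left_limit_def)
  have "lipschitz_minorant \<alpha> f t \<le> ereal (f s + \<alpha> * \<bar>t - s\<bar>)" for s
    unfolding lipschitz_minorant_def by (rule INF_lower) simp
  then show "\<forall>s. min_left_limit f t \<le> f s + \<alpha> * \<bar>t - s\<bar>" by (simp add: eq)
next
  assume *: "\<forall>s. min_left_limit f t \<le> f s + \<alpha> * \<bar>t - s\<bar>"
  have "ereal (min_left_limit f t) \<le> lipschitz_minorant \<alpha> f t"
    unfolding lipschitz_minorant_def by (rule INF_greatest) (simp add: *)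
  moreover have "lipschitz_minorant \<alpha> f t \<le> ereal (min_left_limit f t)"
  proof (rule ccontr)
    assume "\<not> ?thesis"
    then obtain x where x: "ereal (min_left_limit f t) < ereal x" "ereal x < lipschitz_minorant \<alpha> f t"
      using ereal_dense2[of "ereal (min_left_limit f t)"] by (auto simp: not_le)
    obtain y where y: "min_left_limit f t < y" "y < x" using x(1) dense by auto
    obtain q where q: "\<bar>q - t\<bar> < (x - y) / \<alpha>" "f q < y"
      using min_left_limit_less_approx[OF assms(2) y(1), of "(x - y) / \<alpha>"] y assms(1) by auto
    have "lipschitz_minorant \<alpha> f t \<le> ereal (f q + \<alpha> * \<bar>t - q\<bar>)"
      unfolding lipschitz_minorant_def by (rule INF_lower) simp
    with x(2) have "ereal x < ereal (f q + \<alpha> * \<bar>t - q\<bar>)" by (rule less_le_trans)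
    moreover have "\<alpha> * \<bar>t - q\<bar> < x - y" 
      using q(1) assms(1) by (simp add: field_simps abs_minus_commute)
    ultimately show False using q(2) by simp
  qed
  ultimately have "lipschitz_minorant \<alpha> f t = ereal (min_left_limit f t)" by (rule antisym[rotated])
  then show "t \<in> contact_set \<alpha> f" by (simp add: contact_set_def min_left_limit_def)
qed

lemma closed_contact_set:
  assumes "0 < \<alpha>" "cadlag f"
  shows "closed (contact_set \<alpha> f)"
proof -
  have "open (- contact_set \<alpha> f)"
  proof (rule topological_space_class.openI)
    fix t assume "t \<in> - contact_set \<alpha> f"
    then obtain s where s: "f s + \<alpha> * \<bar>t - s\<bar> < min_left_limit f t"
      unfolding Compl_iff contact_set_iff[OF assms] not_all not_le by blast
    then obtain x y where xy: "f s + \<alpha> * \<bar>t - s\<bar> < x" "x < y" "y < min_left_limit f t"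
      by (meson dense)
    have "((\<lambda>u. f s + \<alpha> * \<bar>u - s\<bar>) \<longlongrightarrow> f s + \<alpha> * \<bar>t - s\<bar>) (nhds t)"
      by (intro tendsto_intros filterlim_ident)
    from order_tendstoD(2)[OF this xy(1)] eventually_gt_min_left_limit[OF assms(2) xy(3)]
    have "eventually (\<lambda>u. f s + \<alpha> * \<bar>u - s\<bar> < x \<and> y < f u) (nhds t)"
      by eventually_elim auto
    then obtain T where T: "open T" "t \<in> T" "\<And>u. u \<in> T \<Longrightarrow> f s + \<alpha> * \<bar>u - s\<bar> < x \<and> y < f u"
      unfolding eventually_nhds by blast
    have "u \<notin> contact_set \<alpha> f" if u: "u \<in> T" for u
    proof -
      obtain e where e: "0 < e" "ball u e \<subseteq> T"
        using openE[OF T(1) u] by blast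
      have "y \<le> min_left_limit f u"
      proof (rule le_min_left_limitI[OF assms(2) e(1)])
        fix q assume "\<bar>q - u\<bar> < e"
        then have "q \<in> T" using e(2) by (auto simp: dist_real_def abs_minus_commute)
        then show "y \<le> f q" using T(3) by force
      qed
      with T(3)[OF u] xy(2) have "f s + \<alpha> * \<bar>u - s\<bar> < min_left_limit f u" by simp
      then show ?thesis using contact_set_iff[OF assms, of u] by (meson not_le)
    qed
    with T(1,2) show "\<exists>T. open T \<and> t \<in> T \<and> T \<subseteq> - contact_set \<alpha> f" by blast
  qed
  then show ?thesis by (simp add: closed_def)
qed

lemma cadlag_rational_approx:
  assumes "cadlag f" "continuous_on UNIV h" "f s + h s < (x::real)"
  obtains q where "q \<in> \<rat>" "f q + h q < x"
proof -
  have "((\<lambda>u. f u + h u) \<longlongrightarrow> f s + h s) (at_right s)"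
    using continuous_on_tendsto_compose[OF assms(2), of "\<lambda>x. x" s "at_right s"]
    by (intro tendsto_add cadlag_tendsto_right[OF assms(1)]) auto
  from order_tendstoD(2)[OF this assms(3)]
  obtain b where b: "s < b" "\<And>y. s < y \<Longrightarrow> y < b \<Longrightarrow> f y + h y < x"
    by (auto simp: eventually_at_right_field)
  obtain q where "q \<in> \<rat>" "s < q" "q < b"
    using Rats_dense_in_real[OF b(1)] by auto
  with b(2)[of q] that[of q] show ?thesis by auto
qed

text \<open>A countable criterion, which makes the contact set measurable. Approximate contact at rational
  points is enough: an accumulation point of approximate contact points is a contact point by lower
  semicontinuity, and both ends of the interval are enlarged because a contact at an end point may only
  be visible from outside, through the left limit.\<close>

lemma contact_set_hits_iff:
  assumes "0 < \<alpha>" "cadlag f"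
  shows "contact_set \<alpha> f \<inter> {a..b} \<noteq> {} \<longleftrightarrow>
    (\<forall>n. \<exists>q\<in>\<rat>. a - inverse (real (Suc n)) \<le> q \<and> q \<le> b + inverse (real (Suc n)) \<and>
      (\<forall>s\<in>\<rat>. f q \<le> f s + \<alpha> * \<bar>q - s\<bar> + inverse (real (Suc n))))"
    (is "?L \<longleftrightarrow> (\<forall>n. \<exists>q\<in>\<rat>. ?P n q)")
proof
  assume ?L
  then obtain t where t: "t \<in> contact_set \<alpha> f" "a \<le> t" "t \<le> b" by auto
  show "\<forall>n. \<exists>q\<in>\<rat>. ?P n q"
  proof
    fix n
    define e where "e = inverse (real (Suc n)) / 2"
    have e: "0 < e" "inverse (real (Suc n)) = e + e" by (simp_all add: e_def)
    obtain q where q: "q \<in> \<rat>" "\<bar>q - t\<bar> < min e (e / \<alpha>)" "f q < min_left_limit f t + e"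
      using min_left_limit_less_approx[OF assms(2), of t "min_left_limit f t + e" "min e (e / \<alpha>)"] e(1) assms(1)
      by auto
    have aq: "\<alpha> * \<bar>q - t\<bar> < e"
      using q(2) assms(1) by (simp add: field_simps)
    have "f q \<le> f s + \<alpha> * \<bar>q - s\<bar> + (e + e)" for s
    proof -
      have "min_left_limit f t \<le> f s + \<alpha> * \<bar>t - s\<bar>" using t(1) contact_set_iff[OF assms] by blast
      moreover have "\<alpha> * \<bar>t - s\<bar> \<le> \<alpha> * (\<bar>q - t\<bar> + \<bar>q - s\<bar>)"
        by (rule mult_left_mono) (use assms in auto)
      ultimately show ?thesis using aq q(3) by (simp add: distrib_left)
    qed
    moreover have "a - (e + e) \<le> q" "q \<le> b + (e + e)" using q(2) t e(1) by auto
    ultimately show "\<exists>q\<in>\<rat>. ?P n q" unfolding e(2) using q(1) by blast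
  qed
next
  assume "\<forall>n. \<exists>q\<in>\<rat>. ?P n q"
  then obtain q where q: "\<And>n. ?P n (q n)" by metis
  have inv_le: "inverse (real (Suc n)) \<le> 1" for n by (simp add: field_simps)
  have "q n \<in> {a - 1..b + 1}" for n using q[of n] inv_le[of n] by auto
  then obtain t r where tr: "strict_mono (r :: nat \<Rightarrow> nat)" "(q \<circ> r) \<longlonglongrightarrow> t"
    using compact_Icc[of "a - 1" "b + 1"] unfolding compact_def by metis
  then have qt: "(\<lambda>n. q (r n)) \<longlonglongrightarrow> t" by (simp add: o_def)
  have inv0: "(\<lambda>n. inverse (real (Suc (r n)))) \<longlonglongrightarrow> 0"
    using LIMSEQ_subseq_LIMSEQ[OF LIMSEQ_inverse_real_of_nat tr(1)] by (simp add: o_def)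
  have "a - 0 \<le> t" 
    by (rule LIMSEQ_le[OF tendsto_diff[OF tendsto_const inv0] qt]) (use q in blast)
  moreover have "t \<le> b + 0" 
    by (rule LIMSEQ_le[OF qt tendsto_add[OF tendsto_const inv0]]) (use q in blast)
  moreover have "t \<in> contact_set \<alpha> f"
    unfolding contact_set_iff[OF assms]
  proof (intro allI, rule ccontr)
    fix s assume "\<not> min_left_limit f t \<le> f s + \<alpha> * \<bar>t - s\<bar>"
    then have *: "f s + \<alpha> * \<bar>t - s\<bar> < min_left_limit f t" by simp
    obtain p where p: "p \<in> \<rat>" "f p + \<alpha> * \<bar>t - p\<bar> < min_left_limit f t"
      by (rule cadlag_rational_approx[where h="\<lambda>u. \<alpha> * \<bar>t - u\<bar>", OF assms(2) _ *])
        (auto intro!: continuous_intros)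
    obtain x where x: "f p + \<alpha> * \<bar>t - p\<bar> < x" "x < min_left_limit f t" using dense[OF p(2)] by blast
    have "eventually (\<lambda>n. x < f (q (r n))) sequentially"
      using eventually_compose_filterlim[OF eventually_gt_min_left_limit[OF assms(2) x(2)] qt] .
    moreover have "(\<lambda>n. f p + \<alpha> * \<bar>q (r n) - p\<bar> + inverse (real (Suc (r n))))
        \<longlonglongrightarrow> f p + \<alpha> * \<bar>t - p\<bar> + 0"
      by (intro tendsto_intros qt inv0)
    then have "eventually (\<lambda>n. f p + \<alpha> * \<bar>q (r n) - p\<bar> + inverse (real (Suc (r n))) < x)
        sequentially"
      using order_tendstoD(2)[of _ "f p + \<alpha> * \<bar>t - p\<bar> + 0"] x(1) by auto
    ultimately have "eventually (\<lambda>n. False) sequentially"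
    proof eventually_elim
      case (elim n)
      have "f (q (r n)) \<le> f p + \<alpha> * \<bar>q (r n) - p\<bar> + inverse (real (Suc (r n)))"
        using q[of "r n"] p(1) by blast
      with elim show ?case by linarith
    qed
    then show False by simp
  qed
  ultimately show ?L by auto
qed

text \<open>The slack \<open>\<alpha> - \<beta>\<close> confines minimising sequences of \<open>f s + \<alpha> * \<bar>s\<bar>\<close> to a compact set, and
  every accumulation point of such a sequence is a contact point by the triangle inequality.\<close>

lemma contact_set_nonempty:
  assumes "0 < \<alpha>" "cadlag f" "\<beta> < \<alpha>" "\<And>q. q \<in> \<rat> \<Longrightarrow> c \<le> f q + \<beta> * \<bar>q\<bar>"
  shows "contact_set \<alpha> f \<noteq> {}"
proof -
  define g where "g s = f s + \<alpha> * \<bar>s\<bar>" for s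
  have bound: "c + (\<alpha> - \<beta>) * \<bar>s\<bar> \<le> g s" for s
  proof (rule ccontr)
    assume "\<not> ?thesis"
    then have *: "f s + \<beta> * \<bar>s\<bar> < c" by (simp add: g_def algebra_simps)
    obtain q where "q \<in> \<rat>" "f q + \<beta> * \<bar>q\<bar> < c"
      by (rule cadlag_rational_approx[where h="\<lambda>u. \<beta> * \<bar>u\<bar>", OF assms(2) _ *])
        (auto intro!: continuous_intros)
    with assms(4)[of q] show False by simp
  qed
  have "c \<le> g s" for s
  proof -
    have "0 \<le> (\<alpha> - \<beta>) * \<bar>s\<bar>" using assms(3) by simp
    with bound[of s] show ?thesis by linarith
  qed
  then have bdd: "bdd_below (range g)" by (intro bdd_belowI[of _ c]) auto
  define m where "m = Inf (range g)"
  have m: "m \<le> g s" for s unfolding m_def by (rule cInf_lower[OF _ bdd]) simp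
  have "\<exists>s. g s < m + inverse (real (Suc n))" for n
    using cInf_lessD[of "range g" "m + inverse (real (Suc n))"] by (auto simp: m_def)
  then obtain q where q: "\<And>n. g (q n) < m + inverse (real (Suc n))" by metis
  define R where "R = (m + 1 - c) / (\<alpha> - \<beta>)"
  have "q n \<in> {-R..R}" for n
  proof -
    have "inverse (real (Suc n)) \<le> 1" by (simp add: field_simps)
    with q[of n] bound[of "q n"] have "(\<alpha> - \<beta>) * \<bar>q n\<bar> \<le> m + 1 - c" by simp
    then have "\<bar>q n\<bar> \<le> R" unfolding R_def using assms(3) by (simp add: field_simps)
    then show ?thesis by auto
  qed
  then obtain t r where tr: "strict_mono (r :: nat \<Rightarrow> nat)" "(q \<circ> r) \<longlonglongrightarrow> t"
    using compact_Icc[of "-R" R] unfolding compact_def by metis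
  then have qt: "(\<lambda>n. q (r n)) \<longlonglongrightarrow> t" by (simp add: o_def)
  have inv0: "(\<lambda>n. inverse (real (Suc (r n)))) \<longlonglongrightarrow> 0"
    using LIMSEQ_subseq_LIMSEQ[OF LIMSEQ_inverse_real_of_nat tr(1)] by (simp add: o_def)
  have low: "min_left_limit f t + \<alpha> * \<bar>t\<bar> \<le> m"
  proof (rule ccontr)
    assume "\<not> ?thesis"
    then obtain x where x: "m - \<alpha> * \<bar>t\<bar> < x" "x < min_left_limit f t"
      using dense[of "m - \<alpha> * \<bar>t\<bar>" "min_left_limit f t"] by auto
    have "eventually (\<lambda>n. x < f (q (r n))) sequentially"
      using eventually_compose_filterlim[OF eventually_gt_min_left_limit[OF assms(2) x(2)] qt] .
    moreover have "(\<lambda>n. m + inverse (real (Suc (r n))) - \<alpha> * \<bar>q (r n)\<bar>)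
        \<longlonglongrightarrow> m + 0 - \<alpha> * \<bar>t\<bar>"
      by (intro tendsto_intros qt inv0)
    then have "eventually (\<lambda>n. m + inverse (real (Suc (r n))) - \<alpha> * \<bar>q (r n)\<bar> < x) sequentially"
      using order_tendstoD(2)[of _ "m + 0 - \<alpha> * \<bar>t\<bar>"] x(1) by auto
    ultimately have "eventually (\<lambda>n. False) sequentially"
    proof eventually_elim
      case (elim n)
      with q[of "r n"] show ?case by (simp add: g_def)
    qed
    then show False by simp
  qed
  have "min_left_limit f t \<le> f s + \<alpha> * \<bar>t - s\<bar>" for s
  proof -
    have "\<alpha> * \<bar>s\<bar> \<le> \<alpha> * (\<bar>t - s\<bar> + \<bar>t\<bar>)" by (rule mult_left_mono) (use assms in auto)
    with m[of s] low show ?thesis by (simp add: g_def distrib_left)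
  qed
  then show ?thesis using contact_set_iff[OF assms(1,2)] by blast
qed

definition recentre :: "real \<Rightarrow> (real \<Rightarrow> real) \<Rightarrow> real \<Rightarrow> real" where
  "recentre r f = (\<lambda>t. f (t + r) - f r)"

lemma
  fixes f :: "real \<Rightarrow> real"
  assumes "cadlag f"
  shows cadlag_recentre: "cadlag (recentre r f)"
    and min_left_limit_recentre: "min_left_limit (recentre r f) t = min_left_limit f (t + r) - f r"
proof -
  have R: "((\<lambda>u. f (u + r) - f r) \<longlongrightarrow> f (t + r) - f r) (at_right t)" for t
  proof -
    have "filterlim (\<lambda>u. u + r) (at_right (t + r)) (at_right t)"
      by (auto simp: filterlim_at eventually_at_filter intro!: tendsto_intros)
    from filterlim_compose[OF cadlag_tendsto_right[OF assms] this]
    show ?thesis by (intro tendsto_diff tendsto_const)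
  qed
  have L: "((\<lambda>u. f (u + r) - f r) \<longlongrightarrow> Lim (at_left (t + r)) f - f r) (at_left t)" for t
  proof -
    have "filterlim (\<lambda>u. u + r) (at_left (t + r)) (at_left t)"
      by (auto simp: filterlim_at eventually_at_filter intro!: tendsto_intros)
    from filterlim_compose[OF cadlag_tendsto_left[OF assms] this]
    show ?thesis by (intro tendsto_diff tendsto_const)
  qed
  show "cadlag (recentre r f)"
    unfolding cadlag_def recentre_def continuous_within using R L by blast
  show "min_left_limit (recentre r f) t = min_left_limit f (t + r) - f r"
    unfolding min_left_limit_def recentre_def tendsto_Lim[OF trivial_limit_at_left_real L] by (simp add: min_def)
qed

lemma contact_set_recentre:
  assumes "0 < \<alpha>" "cadlag f"
  shows "contact_set \<alpha> (recentre r f) = (\<lambda>t. t - r) ` contact_set \<alpha> f"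
proof -
  have "t \<in> contact_set \<alpha> (recentre r f) \<longleftrightarrow> t + r \<in> contact_set \<alpha> f" for t
  proof -
    have "t \<in> contact_set \<alpha> (recentre r f) \<longleftrightarrow> (\<forall>s. min_left_limit f (t + r) \<le> f (s + r) + \<alpha> * \<bar>t - s\<bar>)"
      by (simp add: contact_set_iff[OF assms(1) cadlag_recentre[OF assms(2)]] min_left_limit_recentre[OF assms(2)])
        (simp add: recentre_def)
    also have "\<dots> \<longleftrightarrow> (\<forall>s. min_left_limit f (t + r) \<le> f s + \<alpha> * \<bar>t + r - s\<bar>)"
    proof (intro iffI allI)
      fix s assume "\<forall>s. min_left_limit f (t + r) \<le> f (s + r) + \<alpha> * \<bar>t - s\<bar>"
      from this[rule_format, of "s - r"]
      show "min_left_limit f (t + r) \<le> f s + \<alpha> * \<bar>t + r - s\<bar>" by (simp add: diff_diff_eq2)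
    next
      fix s assume "\<forall>s. min_left_limit f (t + r) \<le> f s + \<alpha> * \<bar>t + r - s\<bar>"
      from this[rule_format, of "s + r"]
      show "min_left_limit f (t + r) \<le> f (s + r) + \<alpha> * \<bar>t - s\<bar>" by simp
    qed
    finally show ?thesis by (simp add: contact_set_iff[OF assms])
  qed
  moreover have "t \<in> (\<lambda>t. t - r) ` A \<longleftrightarrow> t + r \<in> A" for t A
    by (metis (no_types, lifting) add_diff_cancel_right' diff_add_cancel imageE imageI)
  ultimately show ?thesis by blast
qed

text \<open>Recentring at \<open>r\<close> moves the end points of the gap by \<open>-r\<close>; neither the excursion over the
  gap nor the path recentred at the right end notices.\<close>

lemma excursion_recentre:
  "excursion (recentre r f) (g - r) (d - r) = excursion f g d"
  by (auto simp: excursion_def recentre_def fun_eq_iff algebra_simps)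

lemma recentre_recentre: "recentre (d - r) (recentre r f) = recentre d f"
  by (auto simp: recentre_def fun_eq_iff algebra_simps)

section \<open>Gaps of a closed set of reals\<close>

lemma discrete_imp_countable:
  fixes S :: "'a::second_countable_topology set"
  assumes "topological_space_class.discrete S"
  shows "countable S"
proof -
  obtain B :: "'a set set" where B: "countable B" "topological_basis B"
    using ex_countable_basis by blast
  have "\<exists>b\<in>B. b \<inter> S = {x}" if x: "x \<in> S" for x
  proof -
    obtain T where T: "open T" "T \<inter> S = {x}"
      using discreteD[OF assms x] by (auto simp: isolated_in_def)
    obtain b where "b \<in> B" "x \<in> b" "b \<subseteq> T"
      using topological_basisE[OF B(2) T(1), of x] T(2) by blast
    with T(2) x show ?thesis by blast
  qed
  then obtain b where b: "\<And>x. x \<in> S \<Longrightarrow> b x \<in> B \<and> b x \<inter> S = {x}" by metis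
  have "inj_on b S" using b by (metis inj_onI singleton_inject)
  moreover have "countable (b ` S)" using b B(1) by (auto intro: countable_subset)
  ultimately show ?thesis by (rule countable_image_inj_on[rotated])
qed

lemma gap_straddles:
  fixes Z :: "real set"
  assumes "closed Z" "Z \<inter> {..<r} \<noteq> {}" "Z \<inter> {r<..} \<noteq> {}" "r \<notin> Z"
  shows "Sup (Z \<inter> {..<r}) < r" "r < Inf (Z \<inter> {r<..})"
proof -
  have "Z \<inter> {..<r} = Z \<inter> {..r}" using assms(4) by (auto simp: less_le)
  moreover have "Sup (Z \<inter> {..r}) \<in> Z \<inter> {..r}"
    using assms calculation
    by (intro closed_contains_Sup closed_Int bdd_aboveI[of _ r]) auto
  ultimately show "Sup (Z \<inter> {..<r}) < r" using assms(4) by force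
  have "Z \<inter> {r<..} = Z \<inter> {r..}" using assms(4) by (auto simp: less_le)
  moreover have "Inf (Z \<inter> {r..}) \<in> Z \<inter> {r..}"
    using assms calculation
    by (intro closed_contains_Inf closed_Int bdd_belowI[of _ r]) auto
  ultimately show "r < Inf (Z \<inter> {r<..})" using assms(4) by force
qed

text \<open>Stated in terms of the two parts of \<open>Z\<close> rather than of the end points, so that it applies with \<open>r\<close>
  and \<open>s\<close> exchanged: lying in the same gap is a symmetric relation.\<close>

lemma gap_unique:
  fixes Z :: "real set"
  assumes "r \<notin> Z" "s \<notin> Z" "Sup (Z \<inter> {..<r}) < s" "s < Inf (Z \<inter> {r<..})"
  shows "Z \<inter> {..<s} = Z \<inter> {..<r}" "Z \<inter> {s<..} = Z \<inter> {r<..}"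
proof -
  have up: "z \<le> Sup (Z \<inter> {..<r})" if "z \<in> Z" "z < r" for z
    by (rule cSup_upper[OF _ bdd_aboveI[of _ r]]) (use that in auto)
  have low: "Inf (Z \<inter> {r<..}) \<le> z" if "z \<in> Z" "r < z" for z
    by (rule cInf_lower[OF _ bdd_belowI[of _ r]]) (use that in auto)
  have "z < s \<longleftrightarrow> z < r" "s < z \<longleftrightarrow> r < z" if "z \<in> Z" for z
    using up[OF that] low[OF that] assms that by (metis less_trans linorder_neqE not_le)+
  then show "Z \<inter> {..<s} = Z \<inter> {..<r}" "Z \<inter> {s<..} = Z \<inter> {r<..}" by auto
qed

lemma
  fixes Z :: "real set"
  shows Sup_negative_translate:
      "Z \<inter> {..<r} \<noteq> {} \<Longrightarrow> Sup ((\<lambda>t. t - r) ` Z \<inter> {..<0}) = Sup (Z \<inter> {..<r}) - r"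
    and Inf_positive_translate:
      "Z \<inter> {r<..} \<noteq> {} \<Longrightarrow> Inf ((\<lambda>t. t - r) ` Z \<inter> {0<..}) = Inf (Z \<inter> {r<..}) - r"
proof -
  have "(\<lambda>t. t - r) ` Z \<inter> {..<0} = (\<lambda>t. - r + t) ` (Z \<inter> {..<r})"
    "(\<lambda>t. t - r) ` Z \<inter> {0<..} = (\<lambda>t. - r + t) ` (Z \<inter> {r<..})" by auto
  moreover have "bdd_above (Z \<inter> {..<r})" "bdd_below (Z \<inter> {r<..})"
    by (intro bdd_aboveI[of _ r] bdd_belowI[of _ r]; auto)+
  ultimately show "Z \<inter> {..<r} \<noteq> {} \<Longrightarrow> Sup ((\<lambda>t. t - r) ` Z \<inter> {..<0}) = Sup (Z \<inter> {..<r}) - r"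
    "Z \<inter> {r<..} \<noteq> {} \<Longrightarrow> Inf ((\<lambda>t. t - r) ` Z \<inter> {0<..}) = Inf (Z \<inter> {r<..}) - r"
    using Sup_add_eq[of "\<lambda>x. x" "Z \<inter> {..<r}" "-r"] Inf_add_eq[of "\<lambda>x. x" "Z \<inter> {r<..}" "-r"]
    by simp_all
qed

definition last_contact :: "real \<Rightarrow> (real \<Rightarrow> real) \<Rightarrow> real" where
  "last_contact \<alpha> f = Sup (contact_set \<alpha> f \<inter> {..<0})"

definition next_contact :: "real \<Rightarrow> (real \<Rightarrow> real) \<Rightarrow> real" where
  "next_contact \<alpha> f = Inf (contact_set \<alpha> f \<inter> {0<..})"

text \<open>The first claim is the symmetry behind the mass transport: the point \<open>-r\<close> lies in the gap of the
  origin for the path recentred at \<open>r\<close> exactly if \<open>r\<close> lies in the gap of the origin for the path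
  itself.\<close>

lemma contact_gap:
  assumes "0 < \<alpha>" "cadlag f" "0 \<notin> contact_set \<alpha> f" "r \<notin> contact_set \<alpha> f"
    and unb: "\<And>s. contact_set \<alpha> f \<inter> {..<s} \<noteq> {}" "\<And>s. contact_set \<alpha> f \<inter> {s<..} \<noteq> {}"
  shows "last_contact \<alpha> (recentre r f) + r < 0 \<and> 0 < next_contact \<alpha> (recentre r f) + r \<longleftrightarrow>
      last_contact \<alpha> f < r \<and> r < next_contact \<alpha> f" (is ?swap)
    and "last_contact \<alpha> f < r \<Longrightarrow> r < next_contact \<alpha> f \<Longrightarrow>
      last_contact \<alpha> (recentre r f) = last_contact \<alpha> f - r \<and>
      next_contact \<alpha> (recentre r f) = next_contact \<alpha> f - r"
    and "last_contact \<alpha> f < 0" "0 < next_contact \<alpha> f"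
proof -
  let ?Z = "contact_set \<alpha> f"
  have closed: "closed ?Z" by (rule closed_contact_set[OF assms(1,2)])
  have shifted: "last_contact \<alpha> (recentre r f) = Sup (?Z \<inter> {..<r}) - r"
    "next_contact \<alpha> (recentre r f) = Inf (?Z \<inter> {r<..}) - r"
    unfolding last_contact_def next_contact_def contact_set_recentre[OF assms(1,2)]
    by (rule Sup_negative_translate[OF unb(1)] Inf_positive_translate[OF unb(2)])+
  note r = gap_straddles[OF closed unb(1) unb(2) assms(4)]
  note zero = gap_straddles[OF closed unb(1) unb(2) assms(3)]
  show "last_contact \<alpha> f < 0" "0 < next_contact \<alpha> f"
    using zero by (simp_all add: last_contact_def next_contact_def)
  have same: "?Z \<inter> {..<r} = ?Z \<inter> {..<0}" "?Z \<inter> {r<..} = ?Z \<inter> {0<..}"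
    if "last_contact \<alpha> f < r" "r < next_contact \<alpha> f"
    using gap_unique[OF assms(3,4)] that by (simp_all add: last_contact_def next_contact_def)
  then show "last_contact \<alpha> (recentre r f) = last_contact \<alpha> f - r \<and>
      next_contact \<alpha> (recentre r f) = next_contact \<alpha> f - r"
    if "last_contact \<alpha> f < r" "r < next_contact \<alpha> f"
    using that unfolding shifted by (simp add: last_contact_def next_contact_def)
  show ?swap
  proof
    assume "last_contact \<alpha> (recentre r f) + r < 0 \<and> 0 < next_contact \<alpha> (recentre r f) + r"
    then have "?Z \<inter> {..<0} = ?Z \<inter> {..<r}" "?Z \<inter> {0<..} = ?Z \<inter> {r<..}"
      using gap_unique[OF assms(4,3)] by (simp_all add: shifted)
    with r show "last_contact \<alpha> f < r \<and> r < next_contact \<alpha> f"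
      by (simp add: last_contact_def next_contact_def)
  next
    assume "last_contact \<alpha> f < r \<and> r < next_contact \<alpha> f"
    with same zero show "last_contact \<alpha> (recentre r f) + r < 0 \<and> 0 < next_contact \<alpha> (recentre r f) + r"
      by (simp add: shifted)
  qed
qed

section \<open>Measurability on the space of right-continuous paths with left limits\<close>

text \<open>The paths under consideration do not form a measurable subset of the uncountable product, and
  neither the end points of the gap nor evaluation at a random time is measurable there. The trace of the
  product \<open>\<sigma>\<close>-algebra on these paths has both properties, since a path is determined by its values at
  rational times.\<close>

definition path_space :: "(real \<Rightarrow> real) measure" where
  "path_space = restrict_space (\<Pi>\<^sub>M t\<in>UNIV. borel) (Collect cadlag)"

lemma space_path_space [simp]: "space path_space = Collect cadlag"
  by (simp add: path_space_def space_restrict_space space_PiM)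

lemma measurable_path_spaceI:
  assumes "\<And>t. (\<lambda>x. F x t) \<in> borel_measurable M" "\<And>x. x \<in> space M \<Longrightarrow> cadlag (F x)"
  shows "F \<in> M \<rightarrow>\<^sub>M path_space"
  unfolding path_space_def
  by (rule measurable_restrict_space2) (use assms in \<open>auto intro!: measurable_PiM_single'\<close>)

lemma measurable_path_eval_at: "(\<lambda>f. f t) \<in> borel_measurable path_space"
  unfolding path_space_def by (rule measurable_restrict_space1) simp

text \<open>Right continuity: a path is the limit of its values on ever finer grids, approached from the
  right.\<close>

lemma measurable_path_eval:
  "(\<lambda>p. fst p (snd p)) \<in> borel_measurable (path_space \<Otimes>\<^sub>M borel)"
proof (rule borel_measurable_LIMSEQ_real)
  let ?q = "\<lambda>n t. (real_of_int \<lfloor>real (Suc n) * t\<rfloor> + 1) / real (Suc n)"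
  show "(\<lambda>p. fst p (?q n (snd p))) \<in> borel_measurable (path_space \<Otimes>\<^sub>M borel)" for n
  proof (rule measurable_compose_countable[where g="\<lambda>p. \<lfloor>real (Suc n) * snd p\<rfloor>"
        and f="\<lambda>k p. fst p ((real_of_int k + 1) / real (Suc n))"])
    show "(\<lambda>p. fst p ((real_of_int k + 1) / real (Suc n))) \<in> borel_measurable (path_space \<Otimes>\<^sub>M borel)" for k
      by (rule measurable_compose[OF measurable_fst measurable_path_eval_at])
  qed measurable
  fix p :: "(real \<Rightarrow> real) \<times> real" assume "p \<in> space (path_space \<Otimes>\<^sub>M borel)"
  then have c: "cadlag (fst p)" by (auto simp: space_pair_measure)
  define t where "t = snd p"
  have gt: "t < ?q n t" for n
  proof -
    have "real (Suc n) * t < real_of_int \<lfloor>real (Suc n) * t\<rfloor> + 1" by linarith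
    then show ?thesis by (simp add: field_simps)
  qed
  have le: "?q n t \<le> t + inverse (real (Suc n))" for n
  proof -
    have "real_of_int \<lfloor>real (Suc n) * t\<rfloor> \<le> real (Suc n) * t" by linarith
    then show ?thesis by (simp add: divide_simps distrib_left del: of_nat_Suc) (simp add: mult.commute)
  qed
  have "(\<lambda>n. ?q n t) \<longlonglongrightarrow> t"
  proof (rule tendsto_sandwich[OF _ _ tendsto_const])
    show "(\<lambda>n. t + inverse (real (Suc n))) \<longlonglongrightarrow> t"
      using tendsto_add[OF tendsto_const LIMSEQ_inverse_real_of_nat, of t] by simp
  qed (use gt le in \<open>auto intro!: always_eventually less_imp_le\<close>)
  moreover have "?q n t \<in> {t<..} \<and> ?q n t \<noteq> t" for n
    using gt[of n] by (metis greaterThan_iff less_irrefl)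
  ultimately have "filterlim (\<lambda>n. ?q n t) (at_right t) sequentially"
    unfolding filterlim_at by (intro conjI always_eventually allI) blast+
  from filterlim_compose[OF cadlag_tendsto_right[OF c] this]
  show "(\<lambda>n. fst p (?q n (snd p))) \<longlonglongrightarrow> fst p (snd p)" by (simp add: t_def)
qed

lemma measurable_path_eval':
  assumes "F \<in> M \<rightarrow>\<^sub>M path_space" "T \<in> borel_measurable M"
  shows "(\<lambda>x. F x (T x)) \<in> borel_measurable M"
  using measurable_compose[OF measurable_Pair[OF assms] measurable_path_eval] by simp

lemma measurable_recentre [measurable (raw)]:
  assumes "F \<in> M \<rightarrow>\<^sub>M path_space" "T \<in> borel_measurable M"
  shows "(\<lambda>x. recentre (T x) (F x)) \<in> M \<rightarrow>\<^sub>M path_space"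
proof (rule measurable_path_spaceI)
  note assms[measurable]
  show "(\<lambda>x. recentre (T x) (F x) t) \<in> borel_measurable M" for t
    unfolding recentre_def
    by (rule borel_measurable_diff[OF measurable_path_eval'[OF assms(1), of "\<lambda>x. t + T x"]
          measurable_path_eval'[OF assms]]) measurable
  show "cadlag (recentre (T x) (F x))" if "x \<in> space M" for x
    using measurable_space[OF assms(1) that] by (auto intro: cadlag_recentre)
qed

lemma bex_Rats_iff: "(\<exists>q\<in>\<rat>. Q q) \<longleftrightarrow> (\<exists>q. Q (real_of_rat q))"
  by (auto simp: Rats_def)

lemma ball_Rats_iff: "(\<forall>q\<in>\<rat>. Q q) \<longleftrightarrow> (\<forall>q. Q (real_of_rat q))"
  by (auto simp: Rats_def)

lemma measurable_pred_le:
  fixes g h :: "'b \<Rightarrow> real"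
  assumes [measurable]: "g \<in> borel_measurable M" "h \<in> borel_measurable M"
  shows "Measurable.pred M (\<lambda>x. g x \<le> h x)"
  by measurable

lemma measurable_contact_set_hits:
  assumes "0 < \<alpha>"
  shows "Measurable.pred path_space (\<lambda>f. contact_set \<alpha> f \<inter> {a..b} \<noteq> {})"
proof -
  have "Measurable.pred path_space (\<lambda>f. \<forall>n. \<exists>q. a - inverse (real (Suc n)) \<le> real_of_rat q \<and>
      real_of_rat q \<le> b + inverse (real (Suc n)) \<and> (\<forall>s. f (real_of_rat q) \<le>
        f (real_of_rat s) + \<alpha> * \<bar>real_of_rat q - real_of_rat s\<bar> + inverse (real (Suc n))))"
    by (intro pred_intros_countable pred_intros_conj1' measurable_pred_le borel_measurable_add borel_measurable_const
        measurable_path_eval_at)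
  then show ?thesis
  proof (rule measurable_cong[THEN iffD2, rotated])
    fix f assume "f \<in> space path_space"
    then show "contact_set \<alpha> f \<inter> {a..b} \<noteq> {} \<longleftrightarrow> (\<forall>n. \<exists>q. a - inverse (real (Suc n)) \<le> real_of_rat q \<and>
      real_of_rat q \<le> b + inverse (real (Suc n)) \<and> (\<forall>s. f (real_of_rat q) \<le>
        f (real_of_rat s) + \<alpha> * \<bar>real_of_rat q - real_of_rat s\<bar> + inverse (real (Suc n))))"
      using contact_set_hits_iff[OF assms, of f a b] unfolding bex_Rats_iff ball_Rats_iff by simp
  qed
qed

lemma rational_between: "a < (b::real) \<Longrightarrow> \<exists>q. a < real_of_rat q \<and> real_of_rat q < b"
  using Rats_dense_in_real[of a b] by (auto simp: Rats_def)

text \<open>The second disjunct covers a path without contact on the negative half-line, for which the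
  supremum is the fixed number \<open>Sup {}\<close>. The end points are thus measurable functions of all paths and
  not only of almost all.\<close>

lemma less_Sup_negative_iff:
  fixes C :: "real set"
  shows "c < Sup (C \<inter> {..<0}) \<longleftrightarrow>
    (\<exists>p q. real_of_rat q < 0 \<and> c < real_of_rat p \<and> C \<inter> {real_of_rat p..real_of_rat q} \<noteq> {}) \<or>
    (\<not> (\<exists>p q. real_of_rat q < 0 \<and> C \<inter> {real_of_rat p..real_of_rat q} \<noteq> {}) \<and> c < Sup {})"
proof (cases "C \<inter> {..<0} = {}")
  case True
  have no: "C \<inter> {real_of_rat p..real_of_rat q} = {}" if "real_of_rat q < 0" for p q
    using that True unfolding disjoint_iff atLeastAtMost_iff lessThan_iff by (metis le_less_trans)
  show ?thesis unfolding True using no by blast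
next
  case False
  have hit: "\<exists>p q. real_of_rat q < 0 \<and> x < real_of_rat p \<and> C \<inter> {real_of_rat p..real_of_rat q} \<noteq> {}"
    if z: "z \<in> C" "z < 0" "x < z" for z x
  proof -
    obtain p where "x < real_of_rat p" "real_of_rat p < z" using rational_between[OF z(3)] by auto
    moreover obtain q where "z < real_of_rat q" "real_of_rat q < 0"
      using rational_between[OF z(2)] by auto
    ultimately show ?thesis using z by (intro exI[of _ p] exI[of _ q]) auto
  qed
  have "c < Sup (C \<inter> {..<0}) \<longleftrightarrow> (\<exists>z\<in>C \<inter> {..<0}. c < z)"
    by (rule less_cSup_iff[OF False bdd_aboveI[of _ 0]]) auto
  also have "\<dots> \<longleftrightarrow>
      (\<exists>p q. real_of_rat q < 0 \<and> c < real_of_rat p \<and> C \<inter> {real_of_rat p..real_of_rat q} \<noteq> {})"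
    (is "?L \<longleftrightarrow> ?R")
  proof
    assume ?L then show ?R using hit by blast
  next
    assume ?R
    then obtain p q z where "real_of_rat q < 0" "c < real_of_rat p" "z \<in> C"
      "real_of_rat p \<le> z" "z \<le> real_of_rat q"
      unfolding disjoint_iff atLeastAtMost_iff by blast
    then show ?L by (metis IntI lessThan_iff le_less_trans less_le_trans)
  qed
  moreover have "\<exists>p q. real_of_rat q < 0 \<and> C \<inter> {real_of_rat p..real_of_rat q} \<noteq> {}"
  proof -
    obtain z where z: "z \<in> C" "z < 0" using False by auto
    show ?thesis using hit[OF z, of "z - 1"] by auto
  qed
  ultimately show ?thesis by blast
qed

lemma Inf_positive_less_iff:
  fixes C :: "real set"
  shows "Inf (C \<inter> {0<..}) < c \<longleftrightarrow>
    (\<exists>p q. 0 < real_of_rat p \<and> real_of_rat q < c \<and> C \<inter> {real_of_rat p..real_of_rat q} \<noteq> {}) \<or>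
    (\<not> (\<exists>p q. 0 < real_of_rat p \<and> C \<inter> {real_of_rat p..real_of_rat q} \<noteq> {}) \<and> Inf {} < c)"
proof (cases "C \<inter> {0<..} = {}")
  case True
  have no: "C \<inter> {real_of_rat p..real_of_rat q} = {}" if "0 < real_of_rat p" for p q
    using that True unfolding disjoint_iff atLeastAtMost_iff greaterThan_iff by (metis less_le_trans)
  show ?thesis unfolding True using no by blast
next
  case False
  have hit: "\<exists>p q. 0 < real_of_rat p \<and> real_of_rat q < x \<and> C \<inter> {real_of_rat p..real_of_rat q} \<noteq> {}"
    if z: "z \<in> C" "0 < z" "z < x" for z x
  proof -
    obtain p where "0 < real_of_rat p" "real_of_rat p < z" using rational_between[OF z(2)] by auto
    moreover obtain q where "z < real_of_rat q" "real_of_rat q < x"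
      using rational_between[OF z(3)] by auto
    ultimately show ?thesis using z by (intro exI[of _ p] exI[of _ q]) auto
  qed
  have "Inf (C \<inter> {0<..}) < c \<longleftrightarrow> (\<exists>z\<in>C \<inter> {0<..}. z < c)"
    by (rule cInf_less_iff[OF False bdd_belowI[of _ 0]]) auto
  also have "\<dots> \<longleftrightarrow>
      (\<exists>p q. 0 < real_of_rat p \<and> real_of_rat q < c \<and> C \<inter> {real_of_rat p..real_of_rat q} \<noteq> {})"
    (is "?L \<longleftrightarrow> ?R")
  proof
    assume ?L then show ?R using hit by blast
  next
    assume ?R
    then obtain p q z where "0 < real_of_rat p" "real_of_rat q < c" "z \<in> C"
      "real_of_rat p \<le> z" "z \<le> real_of_rat q"
      unfolding disjoint_iff atLeastAtMost_iff by blast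
    then show ?L by (metis IntI greaterThan_iff le_less_trans less_le_trans)
  qed
  moreover have "\<exists>p q. 0 < real_of_rat p \<and> C \<inter> {real_of_rat p..real_of_rat q} \<noteq> {}"
  proof -
    obtain z where z: "z \<in> C" "0 < z" using False by auto
    show ?thesis using hit[OF z, of "z + 1"] by auto
  qed
  ultimately show ?thesis by blast
qed

lemma measurable_last_contact:
  assumes "0 < \<alpha>"
  shows "last_contact \<alpha> \<in> borel_measurable path_space"
proof (subst borel_measurable_iff_greater, intro allI)
  fix c
  show "{f \<in> space path_space. c < last_contact \<alpha> f} \<in> sets path_space"
    unfolding last_contact_def less_Sup_negative_iff pred_def[symmetric]
    by (intro pred_intros_logic(2,3,5) pred_intros_countable pred_intros_conj1' pred_intros_conj2'
        measurable_contact_set_hits assms)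
qed

lemma measurable_next_contact:
  assumes "0 < \<alpha>"
  shows "next_contact \<alpha> \<in> borel_measurable path_space"
proof (subst borel_measurable_iff_less, intro allI)
  fix c
  show "{f \<in> space path_space. next_contact \<alpha> f < c} \<in> sets path_space"
    unfolding next_contact_def Inf_positive_less_iff pred_def[symmetric]
    by (intro pred_intros_logic(2,3,5) pred_intros_countable pred_intros_conj1' pred_intros_conj2'
        measurable_contact_set_hits assms)
qed

lemma measurable_contact_set_misses:
  assumes "0 < \<alpha>"
  shows "{f \<in> space path_space. contact_set \<alpha> f \<inter> {..<0} = {}} \<in> sets path_space"
    and "{f \<in> space path_space. contact_set \<alpha> f \<inter> {0<..} = {}} \<in> sets path_space"
proof -
  have 1: "C \<inter> {..<0} = {} \<longleftrightarrow> (\<forall>p q. real_of_rat q < 0 \<longrightarrow> \<not> C \<inter> {real_of_rat p..real_of_rat q} \<noteq> {})" for C :: "real set"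
  proof (intro iffI allI impI)
    assume *: "\<forall>p q. real_of_rat q < 0 \<longrightarrow> \<not> C \<inter> {real_of_rat p..real_of_rat q} \<noteq> {}"
    show "C \<inter> {..<0} = {}"
    proof (rule equals0I)
      fix z assume z: "z \<in> C \<inter> {..<0}"
      obtain p where "real_of_rat p < z" using rational_between[of "z - 1" z] by auto
      moreover obtain q where "z < real_of_rat q" "real_of_rat q < 0" using rational_between[of z 0] z by auto
      ultimately show False using * z by (metis IntD1 IntI atLeastAtMost_iff empty_iff less_imp_le)
    qed
  next
    fix p q assume "C \<inter> {..<0} = {}" "real_of_rat q < 0"
    then show "\<not> C \<inter> {real_of_rat p..real_of_rat q} \<noteq> {}"
      unfolding disjoint_iff not_not atLeastAtMost_iff lessThan_iff by (metis le_less_trans)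
  qed
  have 2: "C \<inter> {0<..} = {} \<longleftrightarrow> (\<forall>p q. 0 < real_of_rat p \<longrightarrow> \<not> C \<inter> {real_of_rat p..real_of_rat q} \<noteq> {})" for C :: "real set"
  proof (intro iffI allI impI)
    assume *: "\<forall>p q. 0 < real_of_rat p \<longrightarrow> \<not> C \<inter> {real_of_rat p..real_of_rat q} \<noteq> {}"
    show "C \<inter> {0<..} = {}"
    proof (rule equals0I)
      fix z assume z: "z \<in> C \<inter> {0<..}"
      obtain q where "z < real_of_rat q" using rational_between[of z "z + 1"] by auto
      moreover obtain p where "0 < real_of_rat p" "real_of_rat p < z" using rational_between[of 0 z] z by auto
      ultimately show False using * z by (metis IntD1 IntI atLeastAtMost_iff empty_iff less_imp_le)
    qed
  next
    fix p q assume "C \<inter> {0<..} = {}" "0 < real_of_rat p"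
    then show "\<not> C \<inter> {real_of_rat p..real_of_rat q} \<noteq> {}"
      unfolding disjoint_iff not_not atLeastAtMost_iff greaterThan_iff by (metis less_le_trans)
  qed
  show "{f \<in> space path_space. contact_set \<alpha> f \<inter> {..<0} = {}} \<in> sets path_space"
    "{f \<in> space path_space. contact_set \<alpha> f \<inter> {0<..} = {}} \<in> sets path_space"
    unfolding 1 2 pred_def[symmetric]
    by (intro pred_intros_logic(2) pred_intros_countable pred_intros_imp' measurable_contact_set_hits assms)+
qed

lemma measurable_recentred_at_next:
  assumes "0 < \<alpha>"
  shows "(\<lambda>f. recentre (next_contact \<alpha> f) f) \<in> path_space \<rightarrow>\<^sub>M (\<Pi>\<^sub>M t\<in>UNIV. borel)"
proof -
  have "(\<lambda>f. recentre (next_contact \<alpha> f) f) \<in> path_space \<rightarrow>\<^sub>M path_space"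
    by (intro measurable_recentre measurable_next_contact assms) simp
  then show ?thesis by (simp add: path_space_def measurable_restrict_space2_iff)
qed

lemma measurable_straddling_excursion:
  assumes "0 < \<alpha>"
  shows "(\<lambda>f. excursion f (last_contact \<alpha> f) (next_contact \<alpha> f)) \<in>
    path_space \<rightarrow>\<^sub>M borel \<Otimes>\<^sub>M (\<Pi>\<^sub>M s\<in>UNIV. borel)"
proof -
  note [measurable] = measurable_last_contact[OF assms] measurable_next_contact[OF assms]
  have ev: "(\<lambda>f. f (last_contact \<alpha> f + s)) \<in> borel_measurable path_space" for s
    by (rule measurable_path_eval'[where F="\<lambda>f. f"]) measurable
  have "(\<lambda>f. if 0 \<le> s \<and> s < next_contact \<alpha> f - last_contact \<alpha> f
      then f (last_contact \<alpha> f + s) - f (last_contact \<alpha> f) else 0) \<in> borel_measurable path_space" for s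
  proof (rule measurable_If)
    show "(\<lambda>f. f (last_contact \<alpha> f + s) - f (last_contact \<alpha> f)) \<in> borel_measurable path_space"
      using ev[of 0] ev[of s] by simp
    show "{f \<in> space path_space. 0 \<le> s \<and> s < next_contact \<alpha> f - last_contact \<alpha> f} \<in> sets path_space"
      by measurable
  qed simp
  then have "(\<lambda>f s. if 0 \<le> s \<and> s < next_contact \<alpha> f - last_contact \<alpha> f
      then f (last_contact \<alpha> f + s) - f (last_contact \<alpha> f) else 0) \<in> path_space \<rightarrow>\<^sub>M (\<Pi>\<^sub>M s\<in>UNIV. borel)"
    by (intro measurable_PiM_single') auto
  then show ?thesis unfolding excursion_def by measurable
qed

section \<open>Stationarity of the recentred path\<close>

lemma (in prob_space) indep_vars_same_law:
  assumes "indep_vars N X I" "indep_vars N Y I" "\<And>i. i \<in> I \<Longrightarrow> distr M (N i) (X i) = distr M (N i) (Y i)"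
  shows "distr M (PiM I N) (\<lambda>\<omega>. \<lambda>i\<in>I. X i \<omega>) = distr M (PiM I N) (\<lambda>\<omega>. \<lambda>i\<in>I. Y i \<omega>)"
proof (cases "I = {}")
  case False
  have rv: "\<And>i. i \<in> I \<Longrightarrow> random_variable (N i) (X i)" "\<And>i. i \<in> I \<Longrightarrow> random_variable (N i) (Y i)"
    using assms(1,2) by (auto simp: indep_vars_def2)
  have "distr M (PiM I N) (\<lambda>\<omega>. \<lambda>i\<in>I. X i \<omega>) = PiM I (\<lambda>i. distr M (N i) (X i))"
    by (rule indep_vars_iff_distr_eq_PiM'[THEN iffD1, OF False rv(1) assms(1)])
  also have "\<dots> = PiM I (\<lambda>i. distr M (N i) (Y i))"
    by (rule PiM_cong[OF refl assms(3)])
  also have "\<dots> = distr M (PiM I N) (\<lambda>\<omega>. \<lambda>i\<in>I. Y i \<omega>)"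
    by (rule indep_vars_iff_distr_eq_PiM'[THEN iffD1, OF False rv(2) assms(2), symmetric])
  finally show ?thesis .
qed (simp add: restrict_def)

context two_sided_levy
begin

abbreviation sample_path :: "'a \<Rightarrow> real \<Rightarrow> real" where
  "sample_path \<omega> \<equiv> (\<lambda>t. X t \<omega>)"

lemma measurable_sample_path [measurable]: "sample_path \<in> P \<rightarrow>\<^sub>M path_space"
  by (rule measurable_path_spaceI[OF random_variable_X cadlag_paths])

lemma increments_same_law:
  assumes "strict_mono_on {..n} t"
  shows "distr P (\<Pi>\<^sub>M i\<in>{..<n}. borel) (\<lambda>\<omega>. \<lambda>i\<in>{..<n}. X (t (Suc i) + h) \<omega> - X (t i + h) \<omega>) =
    distr P (\<Pi>\<^sub>M i\<in>{..<n}. borel) (\<lambda>\<omega>. \<lambda>i\<in>{..<n}. X (t (Suc i)) \<omega> - X (t i) \<omega>)"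
proof (rule indep_vars_same_law)
  have "strict_mono_on {..n} (\<lambda>i. t i + h)"
    using assms by (simp add: strict_mono_on_def)
  from independent_increments[OF this]
  show "indep_vars (\<lambda>_. borel) (\<lambda>i \<omega>. X (t (Suc i) + h) \<omega> - X (t i + h) \<omega>) {..<n}" .
  show "indep_vars (\<lambda>_. borel) (\<lambda>i \<omega>. X (t (Suc i)) \<omega> - X (t i) \<omega>) {..<n}"
    by (rule independent_increments[OF assms])
  fix i assume "i \<in> {..<n}"
  with assms have "t i \<le> t (Suc i)" by (auto simp: strict_mono_on_def intro!: less_imp_le)
  from stationary_increments[OF this]
  show "distr P borel (\<lambda>\<omega>. X (t (Suc i) + h) \<omega> - X (t i + h) \<omega>) =
    distr P borel (\<lambda>\<omega>. X (t (Suc i)) \<omega> - X (t i) \<omega>)" .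
qed

text \<open>Values of the recentred path are differences of partial sums of its increments along a grid that
  contains the origin, so that equality in law passes from the increments to the values.\<close>

lemma finite_dimensional_stationary:
  assumes "finite J" "\<And>j. j \<in> J \<Longrightarrow> A j \<in> sets borel"
  shows "emeasure P {\<omega> \<in> space P. \<forall>j\<in>J. X (j + h) \<omega> - X h \<omega> \<in> A j} =
    emeasure P {\<omega> \<in> space P. \<forall>j\<in>J. X j \<omega> \<in> A j}"
proof -
  define l where "l = sorted_list_of_set (insert 0 J)"
  have l: "sorted_wrt (<) l" "set l = insert 0 J"
    using assms(1) strict_sorted_list_of_set[of "insert 0 J"] set_sorted_list_of_set[of "insert 0 J"]
    unfolding l_def by blast+
  then have "l \<noteq> []" by auto
  define n where "n = length l - 1"
  have n: "length l = Suc n" using \<open>l \<noteq> []\<close> by (simp add: n_def)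
  define t where "t = (!) l"
  have mono: "strict_mono_on {..n} t"
    using l(1) n by (auto simp: strict_mono_on_def t_def sorted_wrt_iff_nth_less)
  have "\<exists>i\<le>n. t i = j" if "j \<in> insert 0 J" for j
  proof -
    from that have "j \<in> set l" by (simp add: l(2))
    then obtain i where "i < length l" "l ! i = j" unfolding in_set_conv_nth by blast
    then show ?thesis using n unfolding t_def by (intro exI[of _ i]) simp
  qed
  then obtain k where k: "\<And>j. j \<in> insert 0 J \<Longrightarrow> k j \<le> n \<and> t (k j) = j" by metis
  define \<Phi> where "\<Phi> g j = (\<Sum>i<k j. g i) - (\<Sum>i<k 0. g i)" for g :: "nat \<Rightarrow> real" and j
  let ?N = "\<Pi>\<^sub>M i\<in>{..<n}. (borel :: real measure)"
  let ?inc = "\<lambda>h \<omega>. \<lambda>i\<in>{..<n}. X (t (Suc i) + h) \<omega> - X (t i + h) \<omega>"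
  have tele: "\<Phi> (?inc h \<omega>) j = X (j + h) \<omega> - X h \<omega>" if "j \<in> J" for h \<omega> j
  proof -
    have "(\<Sum>i<k j'. ?inc h \<omega> i) = X (t (k j') + h) \<omega> - X (t 0 + h) \<omega>" if "j' \<in> insert 0 J" for j'
    proof -
      have "(\<Sum>i<k j'. ?inc h \<omega> i) = (\<Sum>i<k j'. X (t (Suc i) + h) \<omega> - X (t i + h) \<omega>)"
        by (rule sum.cong) (use k[OF that] in auto)
      also have "\<dots> = X (t (k j') + h) \<omega> - X (t 0 + h) \<omega>"
        by (rule sum_lessThan_telescope)
      finally show ?thesis .
    qed
    from this[of j] this[of 0] k[of j] k[of 0] \<open>j \<in> J\<close> show ?thesis by (simp add: \<Phi>_def)
  qed
  define B where "B = {g \<in> space ?N. \<forall>j\<in>J. \<Phi> g j \<in> A j}"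
  have \<Phi>_meas: "(\<lambda>g. \<Phi> g j) \<in> borel_measurable ?N" if "j \<in> J" for j
    unfolding \<Phi>_def
    by (intro borel_measurable_diff borel_measurable_sum measurable_component_singleton)
      (use k[of j] k[of 0] that in auto)
  have B: "B \<in> sets ?N"
    unfolding B_def
    by (rule sets.sets_Collect_finite_All[OF _ assms(1)])
      (use measurable_sets[OF \<Phi>_meas assms(2)] in \<open>auto simp: vimage_def Int_def conj_commute\<close>)
  have inc_meas: "?inc h \<in> P \<rightarrow>\<^sub>M ?N" for h
    by (intro measurable_restrict borel_measurable_diff random_variable_X)
  have "emeasure P {\<omega> \<in> space P. \<forall>j\<in>J. X (j + h) \<omega> - X h \<omega> \<in> A j} = emeasure (distr P ?N (?inc h)) B" for h
    unfolding emeasure_distr[OF inc_meas B]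
    by (rule arg_cong[where f="emeasure P"])
      (use measurable_space[OF inc_meas] in \<open>auto simp: B_def tele\<close>)
  note this[of h] this[of 0]
  with increments_same_law[OF mono, of h] X_zero show ?thesis by (simp cong: conj_cong)
qed

lemma sample_path_stationary: "distr P path_space (\<lambda>\<omega>. recentre h (sample_path \<omega>)) = distr P path_space sample_path"
proof -
  let ?N = "\<Pi>\<^sub>M t\<in>UNIV. (borel :: real measure)"
  have meas: "(\<lambda>\<omega>. recentre h (sample_path \<omega>)) \<in> P \<rightarrow>\<^sub>M path_space" by measurable
  have to_N: "f \<in> P \<rightarrow>\<^sub>M ?N" if "f \<in> P \<rightarrow>\<^sub>M path_space" for f
    using that unfolding path_space_def by (simp add: measurable_restrict_space2_iff)
  have N_eq: "distr P ?N (\<lambda>\<omega>. recentre h (sample_path \<omega>)) = distr P ?N sample_path"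
  proof (rule measure_eqI_PiM_infinite)
    show "finite_measure (distr P ?N (\<lambda>\<omega>. recentre h (sample_path \<omega>)))"
      by (intro prob_space.finite_measure prob_space_distr to_N meas)
    fix A :: "real \<Rightarrow> real set" and J :: "real set"
    assume J: "finite J" and A: "\<And>j. j \<in> J \<Longrightarrow> A j \<in> sets borel"
    have E: "prod_emb UNIV (\<lambda>_. borel) J (Pi\<^sub>E J A) \<in> sets ?N"
      by (rule sets_PiM_I) (use J A in auto)
    have *: "emeasure (distr P ?N f) (prod_emb UNIV (\<lambda>_. borel) J (Pi\<^sub>E J A)) =
      emeasure P {\<omega> \<in> space P. \<forall>j\<in>J. f \<omega> j \<in> A j}" if "f \<in> P \<rightarrow>\<^sub>M ?N" for f
      unfolding emeasure_distr[OF that E]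
      by (rule arg_cong[where f="emeasure P"]) (auto simp: prod_emb_iff PiE_iff restrict_def extensional_def)
    show "emeasure (distr P ?N (\<lambda>\<omega>. recentre h (sample_path \<omega>))) (prod_emb UNIV (\<lambda>_. borel) J (Pi\<^sub>E J A)) =
      emeasure (distr P ?N sample_path) (prod_emb UNIV (\<lambda>_. borel) J (Pi\<^sub>E J A))"
      unfolding *[OF to_N[OF meas]] *[OF to_N[OF measurable_sample_path]]
      using finite_dimensional_stationary[where h=h, OF J A] by (simp add: recentre_def)
  qed simp_all
  show ?thesis
  proof (rule measure_eqI)
    fix B assume "B \<in> sets (distr P path_space (\<lambda>\<omega>. recentre h (sample_path \<omega>)))"
    then have Bs: "B \<in> sets path_space" by simp
    then obtain A where A: "A \<in> sets ?N" "B = A \<inter> Collect cadlag"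
      by (auto simp: path_space_def sets_restrict_space)
    have "emeasure (distr P path_space f) B = emeasure (distr P ?N f) A" if f: "f \<in> P \<rightarrow>\<^sub>M path_space" for f
      unfolding emeasure_distr[OF f Bs] emeasure_distr[OF to_N[OF f] A(1)]
      by (rule arg_cong[where f="emeasure P"]) (use measurable_space[OF f] A(2) in auto)
    with N_eq meas measurable_sample_path
    show "emeasure (distr P path_space (\<lambda>\<omega>. recentre h (sample_path \<omega>))) B = emeasure (distr P path_space sample_path) B"
      by metis
  qed simp
qed

lemma nn_integral_stationary:
  assumes "k \<in> borel_measurable path_space"
  shows "(\<integral>\<^sup>+\<omega>. k (recentre h (sample_path \<omega>)) \<partial>P) = (\<integral>\<^sup>+\<omega>. k (sample_path \<omega>) \<partial>P)"
proof -
  have meas: "(\<lambda>\<omega>. recentre h (sample_path \<omega>)) \<in> P \<rightarrow>\<^sub>M path_space" by measurable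
  show ?thesis
    using nn_integral_distr[OF meas, of k] nn_integral_distr[OF measurable_sample_path, of k] assms
    by (simp add: sample_path_stationary)
qed

end

section \<open>Random walks with positive drift are bounded below\<close>

lemma (in prob_space) indep_sets_reindex:
  assumes "inj_on f I" "indep_sets F (f ` I)"
  shows "indep_sets (\<lambda>i. F (f i)) I"
  unfolding indep_sets_def
proof (intro conjI ballI allI impI)
  show "F (f i) \<subseteq> events" if "i \<in> I" for i
    using assms(2) that by (auto simp: indep_sets_def)
  fix J A assume J: "J \<subseteq> I" "J \<noteq> {}" "finite J" and A: "A \<in> (\<Pi> i\<in>J. F (f i))"
  define B where "B k = A (inv_into I f k)" for k
  have B: "B (f j) = A j" if "j \<in> J" for j
    unfolding B_def using inv_into_f_f[OF assms(1)] J(1) that by auto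
  have inj: "inj_on f J" using assms(1) J(1) by (rule inj_on_subset)
  have "B \<in> (\<Pi> k\<in>f ` J. F k)" using A B by auto
  moreover have "f ` J \<subseteq> f ` I" "f ` J \<noteq> {}" "finite (f ` J)" using J by auto
  ultimately have "prob (\<Inter>k\<in>f ` J. B k) = (\<Prod>k\<in>f ` J. prob (B k))"
    using assms(2) unfolding indep_sets_def by blast
  then show "prob (\<Inter>j\<in>J. A j) = (\<Prod>j\<in>J. prob (A j))"
    by (simp add: prod.reindex[OF inj] B)
qed

lemma (in prob_space) indep_vars_reindex:
  assumes "inj_on f I" "indep_vars N X (f ` I)"
  shows "indep_vars (\<lambda>i. N (f i)) (\<lambda>i. X (f i)) I"
  using assms indep_sets_reindex[OF assms(1)] unfolding indep_vars_def2 by auto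

text \<open>The maximum over \<open>k \<le> n\<close> of \<open>- (\<Sum>i<k. x i)\<close>. The recursion removes the first step, which turns the maximum of the walk into
  that of the walk with shifted steps.\<close>

primrec lindley :: "nat \<Rightarrow> (nat \<Rightarrow> real) \<Rightarrow> real" where
  "lindley 0 x = 0"
| "lindley (Suc n) x = max 0 (lindley n (\<lambda>i. x (Suc i)) - x 0)"

lemma lindley_nonneg: "0 \<le> lindley n x"
  by (cases n) auto

lemma incseq_lindley: "incseq (\<lambda>n. lindley n x)"
proof (rule incseq_SucI)
  show "lindley n x \<le> lindley (Suc n) x" for n
  proof (induction n arbitrary: x)
    case (Suc n)
    from Suc.IH[of "\<lambda>i. x (Suc i)"] show ?case by (auto simp: max_def)
  qed simp
qed

lemma sum_le_lindley: "- (\<Sum>i<n. x i) \<le> lindley n x"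
proof (induction n arbitrary: x)
  case (Suc n)
  from Suc.IH[of "\<lambda>i. x (Suc i)"] show ?case
    by (simp add: sum.lessThan_Suc_shift del: sum.lessThan_Suc)
qed simp

lemma lindley_le_sum_abs: "lindley n x \<le> (\<Sum>i<n. \<bar>x i\<bar>)"
proof (induction n arbitrary: x)
  case (Suc n)
  from Suc.IH[of "\<lambda>i. x (Suc i)"] show ?case
    by (auto simp: sum.lessThan_Suc_shift simp del: sum.lessThan_Suc intro!: add_nonneg_nonneg sum_nonneg)
qed simp

lemma measurable_lindley: "lindley n \<in> borel_measurable (\<Pi>\<^sub>M i\<in>UNIV. borel)"
proof (induction n)
  case (Suc n)
  have "(\<lambda>x i. x (Suc i)) \<in> (\<Pi>\<^sub>M i\<in>UNIV. borel) \<rightarrow>\<^sub>M (\<Pi>\<^sub>M i\<in>UNIV. (borel :: real measure))"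
    by (rule measurable_PiM_single') auto
  from measurable_compose[OF this Suc] have "(\<lambda>x. lindley n (\<lambda>i. x (Suc i))) \<in> borel_measurable (\<Pi>\<^sub>M i\<in>UNIV. borel)" .
  moreover have "(\<lambda>x. x 0) \<in> (\<Pi>\<^sub>M i\<in>UNIV. borel) \<rightarrow>\<^sub>M (borel :: real measure)"
    by (rule measurable_component_singleton) simp
  ultimately show ?case
    by (simp add: borel_measurable_max borel_measurable_diff)
qed simp

lemma bdd_above_Suc_iff: "bdd_above (range (\<lambda>n. g (Suc n))) \<longleftrightarrow> bdd_above (range (g :: nat \<Rightarrow> real))"
proof -
  have "range g = insert (g 0) (range (\<lambda>n. g (Suc n)))"
    by (auto simp: image_iff) (metis not0_implies_Suc)
  then show ?thesis by simp
qed

lemma bdd_above_lindley_shift: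
  "bdd_above (range (\<lambda>n. lindley n (\<lambda>i. x (Suc i)))) \<longleftrightarrow> bdd_above (range (\<lambda>n. lindley n x))"
proof -
  have "bdd_above (range (\<lambda>n. lindley n x)) \<longleftrightarrow> bdd_above (range (\<lambda>n. lindley (Suc n) x))"
    by (rule bdd_above_Suc_iff[symmetric])
  also have "\<dots> \<longleftrightarrow> bdd_above (range (\<lambda>n. lindley n (\<lambda>i. x (Suc i))))"
  proof
    assume "bdd_above (range (\<lambda>n. lindley (Suc n) x))"
    then obtain c where "\<And>n. lindley (Suc n) x \<le> c" by (auto simp: bdd_above_def)
    then have "lindley n (\<lambda>i. x (Suc i)) \<le> c + x 0" for n by (simp add: max.bounded_iff algebra_simps)
    then show "bdd_above (range (\<lambda>n. lindley n (\<lambda>i. x (Suc i))))" by (intro bdd_aboveI[of _ "c + x 0"]) auto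
  next
    assume "bdd_above (range (\<lambda>n. lindley n (\<lambda>i. x (Suc i))))"
    then obtain c where c: "\<And>n. lindley n (\<lambda>i. x (Suc i)) \<le> c" by (auto simp: bdd_above_def)
    have "lindley (Suc n) x \<le> max 0 (c - x 0)" for n
      unfolding lindley.simps by (intro max.mono diff_mono c order_refl)
    then show "bdd_above (range (\<lambda>n. lindley (Suc n) x))" by (intro bdd_aboveI[of _ "max 0 (c - x 0)"]) blast
  qed
  finally show ?thesis by simp
qed

text \<open>Let \<open>w\<close> and \<open>w'\<close> be the running maxima of the walk with steps \<open>-\<xi> i\<close> and of the walk with the
  shifted steps \<open>-\<xi> (Suc i)\<close>, and let \<open>E\<close> be the event that \<open>w\<close> is unbounded, which is the same for
  both. As \<open>w n\<close> and \<open>w' n\<close> have the same mean over \<open>E\<close> and \<open>w\<close> increases, the mean over \<open>E\<close> of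
  \<open>w (Suc n) - w' n = max (- w' n) (- \<xi> 0)\<close> is nonnegative. On \<open>E\<close> this difference is eventually
  \<open>-\<xi> 0\<close>, so that the mean of \<open>\<xi> 0\<close> over \<open>E\<close> is at most \<open>0\<close>. But \<open>E\<close> depends on the shifted steps
  only, hence that mean is the mean of \<open>\<xi> 0\<close> times the probability of \<open>E\<close>, and \<open>E\<close> is null.\<close>

lemma (in prob_space) random_walk_bounded_below:
  fixes \<xi> :: "nat \<Rightarrow> 'a \<Rightarrow> real"
  assumes ind: "indep_vars (\<lambda>_. borel) \<xi> UNIV"
    and law: "\<And>i. distr M borel (\<xi> i) = distr M borel (\<xi> 0)"
    and int: "integrable M (\<xi> 0)" and pos: "0 < expectation (\<xi> 0)"
  shows "AE \<omega> in M. bdd_below (range (\<lambda>n. \<Sum>i<n. \<xi> i \<omega>))"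
proof -
  let ?N = "\<Pi>\<^sub>M i\<in>(UNIV :: nat set). (borel :: real measure)"
  define A where "A = {x \<in> space ?N. \<not> bdd_above (range (\<lambda>n. lindley n x))}"
  have A_iff: "x \<in> A \<longleftrightarrow> \<not> bdd_above (range (\<lambda>n. lindley n x))" for x
    by (simp add: A_def space_PiM)
  have A_alt: "A = {x \<in> space ?N. \<forall>k::nat. \<exists>n. real k < lindley n x}"
  proof -
    have "\<not> bdd_above (range (\<lambda>n. lindley n x)) \<longleftrightarrow> (\<forall>k::nat. \<exists>n. real k < lindley n x)" for x
    proof
      assume "\<not> bdd_above (range (\<lambda>n. lindley n x))"
      show "\<forall>k::nat. \<exists>n. real k < lindley n x"
      proof (intro allI, rule ccontr)
        fix k :: nat assume "\<not> (\<exists>n. real k < lindley n x)"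
        then have "bdd_above (range (\<lambda>n. lindley n x))"
          by (intro bdd_aboveI[of _ "real k"]) (auto simp: not_less)
        with \<open>\<not> bdd_above _\<close> show False by blast
      qed
    next
      assume *: "\<forall>k::nat. \<exists>n. real k < lindley n x"
      show "\<not> bdd_above (range (\<lambda>n. lindley n x))"
      proof
        assume "bdd_above (range (\<lambda>n. lindley n x))"
        then obtain c where c: "\<And>n. lindley n x \<le> c" by (auto simp: bdd_above_def)
        obtain k :: nat where "c < real k" using reals_Archimedean2 by blast
        moreover obtain n where "real k < lindley n x" using * by blast
        ultimately show False using c[of n] by simp
      qed
    qed
    then show ?thesis by (simp add: A_def)
  qed
  have A [measurable]: "A \<in> sets ?N"
    unfolding A_alt
    by (intro sets.sets_Collect_countable_All sets.sets_Collect_countable_Ex borel_measurable_less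
        measurable_lindley) simp
  have rv [measurable]: "\<xi> i \<in> borel_measurable M" for i
    using ind by (auto simp: indep_vars_def2)
  have int_\<xi>: "integrable M (\<xi> i)" for i
    using int integrable_distr_eq[OF rv, of "\<lambda>x. x" i] integrable_distr_eq[OF rv, of "\<lambda>x. x" 0] law[of i]
    by simp
  define \<Xi> where "\<Xi> \<omega> = (\<lambda>i. \<xi> i \<omega>)" for \<omega>
  define \<Xi>' where "\<Xi>' \<omega> = (\<lambda>i. \<xi> (Suc i) \<omega>)" for \<omega>
  have \<Xi>_meas [measurable]: "\<Xi> \<in> M \<rightarrow>\<^sub>M ?N" "\<Xi>' \<in> M \<rightarrow>\<^sub>M ?N"
    unfolding \<Xi>_def \<Xi>'_def by (auto intro!: measurable_PiM_single')
  have ind': "indep_vars (\<lambda>_. borel) (\<lambda>i. \<xi> (Suc i)) UNIV"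
    by (rule indep_vars_reindex[of Suc UNIV "\<lambda>_. borel" \<xi>]) (auto intro: indep_vars_subset[OF ind])
  have law_eq: "distr M ?N \<Xi> = distr M ?N \<Xi>'"
  proof -
    have "distr M borel (\<xi> i) = distr M borel (\<xi> (Suc i))" for i
      using law[of i] law[of "Suc i"] by simp
    from indep_vars_same_law[OF ind ind' this] show ?thesis
      by (simp add: \<Xi>_def[abs_def] \<Xi>'_def[abs_def] restrict_def)
  qed
  define E where "E = \<Xi> -` A \<inter> space M"
  have E [measurable]: "E \<in> sets M" unfolding E_def by measurable
  have E_iff: "\<omega> \<in> E \<longleftrightarrow> \<Xi> \<omega> \<in> A" "\<omega> \<in> E \<longleftrightarrow> \<Xi>' \<omega> \<in> A" if "\<omega> \<in> space M" for \<omega>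
    using that bdd_above_lindley_shift[of "\<Xi> \<omega>"] by (auto simp: E_def A_iff \<Xi>_def \<Xi>'_def)
  define w where "w n \<omega> = lindley n (\<Xi> \<omega>)" for n \<omega>
  define w' where "w' n \<omega> = lindley n (\<Xi>' \<omega>)" for n \<omega>
  have w_Suc: "w (Suc n) \<omega> = max 0 (w' n \<omega> - \<xi> 0 \<omega>)" for n \<omega>
    by (simp add: w_def w'_def \<Xi>_def \<Xi>'_def)
  have w_meas [measurable]: "w n \<in> borel_measurable M" "w' n \<in> borel_measurable M" for n
    unfolding w_def w'_def by (auto intro: measurable_compose[OF _ measurable_lindley])
  have w_int: "integrable M (w n)" "integrable M (w' n)" for n
  proof -
    show "integrable M (w n)"
      by (rule Bochner_Integration.integrable_bound[of _ "\<lambda>\<omega>. \<Sum>i<n. \<bar>\<xi> i \<omega>\<bar>"])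
        (use int_\<xi> lindley_nonneg[of n] lindley_le_sum_abs[of n] in
          \<open>auto simp: w_def \<Xi>_def intro!: AE_I2 order_trans[OF lindley_le_sum_abs] Bochner_Integration.integrable_sum\<close>)
    show "integrable M (w' n)"
      by (rule Bochner_Integration.integrable_bound[of _ "\<lambda>\<omega>. \<Sum>i<n. \<bar>\<xi> (Suc i) \<omega>\<bar>"])
        (use int_\<xi> lindley_nonneg[of n] lindley_le_sum_abs[of n] in
          \<open>auto simp: w'_def \<Xi>'_def intro!: AE_I2 order_trans[OF lindley_le_sum_abs] Bochner_Integration.integrable_sum\<close>)
  qed
  have w_E_eq: "(\<integral>\<omega>. w n \<omega> * indicator E \<omega> \<partial>M) = (\<integral>\<omega>. w' n \<omega> * indicator E \<omega> \<partial>M)" for n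
  proof -
    let ?k = "\<lambda>x. lindley n x * indicator A x"
    have k: "?k \<in> borel_measurable ?N"
      by (intro borel_measurable_times measurable_lindley borel_measurable_indicator A)
    have "(\<integral>\<omega>. w n \<omega> * indicator E \<omega> \<partial>M) = (\<integral>\<omega>. ?k (\<Xi> \<omega>) \<partial>M)"
      by (rule Bochner_Integration.integral_cong) (auto simp: w_def indicator_def E_iff(1))
    also have "\<dots> = integral\<^sup>L (distr M ?N \<Xi>) ?k"
      by (rule integral_distr[symmetric, OF \<Xi>_meas(1) k])
    also have "\<dots> = (\<integral>\<omega>. ?k (\<Xi>' \<omega>) \<partial>M)"
      unfolding law_eq by (rule integral_distr[OF \<Xi>_meas(2) k])
    also have "\<dots> = (\<integral>\<omega>. w' n \<omega> * indicator E \<omega> \<partial>M)"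
      by (rule Bochner_Integration.integral_cong) (auto simp: w'_def indicator_def E_iff(2))
    finally show ?thesis .
  qed
  define d where "d n \<omega> = max (- w' n \<omega>) (- \<xi> 0 \<omega>) * indicator E \<omega>" for n \<omega>
  have d_nonneg: "0 \<le> (\<integral>\<omega>. d n \<omega> \<partial>M)" for n
  proof -
    have intE: "integrable M (\<lambda>\<omega>. w n \<omega> * indicator E \<omega>)" "integrable M (\<lambda>\<omega>. w' n \<omega> * indicator E \<omega>)" for n
      using w_int[of n] by (auto intro!: integrable_real_mult_indicator)
    have "(\<integral>\<omega>. w n \<omega> * indicator E \<omega> \<partial>M) \<le> (\<integral>\<omega>. w (Suc n) \<omega> * indicator E \<omega> \<partial>M)"
      by (rule integral_mono[OF intE(1) intE(1)])
        (auto intro!: mult_right_mono incseq_SucD[OF incseq_lindley] simp: w_def simp del: lindley.simps)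
    then have "0 \<le> (\<integral>\<omega>. w (Suc n) \<omega> * indicator E \<omega> \<partial>M) - (\<integral>\<omega>. w' n \<omega> * indicator E \<omega> \<partial>M)"
      by (simp add: w_E_eq)
    also have "\<dots> = (\<integral>\<omega>. w (Suc n) \<omega> * indicator E \<omega> - w' n \<omega> * indicator E \<omega> \<partial>M)"
      by (rule Bochner_Integration.integral_diff[symmetric, OF intE(1) intE(2)])
    also have "\<dots> = (\<integral>\<omega>. d n \<omega> \<partial>M)"
      by (rule Bochner_Integration.integral_cong) (auto simp: d_def w_Suc max_def indicator_def)
    finally show ?thesis .
  qed
  have "(\<lambda>n. \<integral>\<omega>. d n \<omega> \<partial>M) \<longlonglongrightarrow> (\<integral>\<omega>. - \<xi> 0 \<omega> * indicator E \<omega> \<partial>M)"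
  proof (rule integral_dominated_convergence[where w="\<lambda>\<omega>. \<bar>\<xi> 0 \<omega>\<bar>"])
    show "AE \<omega> in M. (\<lambda>n. d n \<omega>) \<longlonglongrightarrow> - \<xi> 0 \<omega> * indicator E \<omega>"
    proof (rule AE_I2)
      fix \<omega> assume \<omega>: "\<omega> \<in> space M"
      show "(\<lambda>n. d n \<omega>) \<longlonglongrightarrow> - \<xi> 0 \<omega> * indicator E \<omega>"
      proof (cases "\<omega> \<in> E")
        case True
        then have "\<not> bdd_above (range (\<lambda>n. w' n \<omega>))"
          using E_iff(2)[OF \<omega>] by (simp add: A_iff w'_def)
        then have "\<exists>n0. \<not> w' n0 \<omega> \<le> \<xi> 0 \<omega>"
          using bdd_aboveI[of "range (\<lambda>n. w' n \<omega>)" "\<xi> 0 \<omega>"] by auto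
        then obtain n0 where n0: "\<xi> 0 \<omega> \<le> w' n0 \<omega>" 
          by (meson nle_le)
        have "\<xi> 0 \<omega> \<le> w' n \<omega>" if "n0 \<le> n" for n
          using incseqD[OF incseq_lindley that, of "\<Xi>' \<omega>"] n0 by (simp add: w'_def)
        then have "eventually (\<lambda>n. d n \<omega> = - \<xi> 0 \<omega> * indicator E \<omega>) sequentially"
          unfolding eventually_sequentially d_def by (intro exI[of _ n0]) (auto simp: max_def)
        then show ?thesis by (rule tendsto_eventually)
      qed (simp add: d_def)
    qed
    show "AE \<omega> in M. norm (d n \<omega>) \<le> \<bar>\<xi> 0 \<omega>\<bar>" for n
      using lindley_nonneg[of n] by (intro AE_I2) (auto simp: d_def w'_def max_def indicator_def)
  qed (use int in \<open>auto simp: d_def\<close>)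
  from LIMSEQ_le_const[OF this, of 0] d_nonneg
  have "(\<integral>\<omega>. \<xi> 0 \<omega> * indicator E \<omega> \<partial>M) \<le> 0" by simp
  moreover have "(\<integral>\<omega>. \<xi> 0 \<omega> * indicator E \<omega> \<partial>M) = expectation (\<xi> 0) * prob E"
  proof -
    let ?R = "\<lambda>K \<omega>. restrict (\<lambda>i. \<xi> i \<omega>) K"
    let ?f = "\<lambda>x :: nat \<Rightarrow> real. indicator A (\<lambda>i. x (Suc i)) :: real"
    have "(\<lambda>x i. x (Suc i)) \<in> (\<Pi>\<^sub>M i\<in>{1..}. borel) \<rightarrow>\<^sub>M ?N"
      by (rule measurable_PiM_single') auto
    then have f: "?f \<in> borel_measurable (\<Pi>\<^sub>M i\<in>{1..}. borel)"
      by (rule measurable_compose[OF _ borel_measurable_indicator[OF A]])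
    have "indep_var (\<Pi>\<^sub>M i\<in>{0}. borel) (?R {0}) (\<Pi>\<^sub>M i\<in>{1..}. borel) (?R {1..})"
      by (rule indep_var_restrict[OF ind]) auto
    from indep_var_compose[OF this measurable_component_singleton f, of 0]
    have "indep_var borel (\<xi> 0) borel (\<lambda>\<omega>. indicator A (\<Xi>' \<omega>))"
      by (simp add: comp_def \<Xi>'_def)
    then have "(\<integral>\<omega>. \<xi> 0 \<omega> * indicator A (\<Xi>' \<omega>) \<partial>M) = expectation (\<xi> 0) * (\<integral>\<omega>. indicator A (\<Xi>' \<omega>) \<partial>M)"
    proof (rule indep_var_lebesgue_integral[OF _ int])
      show "integrable M (\<lambda>\<omega>. indicator A (\<Xi>' \<omega>) :: real)"
        by (rule integrable_const_bound[of _ 1]) (auto simp: indicator_def)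
    qed
    moreover have "(\<integral>\<omega>. \<xi> 0 \<omega> * indicator A (\<Xi>' \<omega>) \<partial>M) = (\<integral>\<omega>. \<xi> 0 \<omega> * indicator E \<omega> \<partial>M)"
      by (rule Bochner_Integration.integral_cong) (auto simp: indicator_def E_iff(2))
    moreover have "(\<integral>\<omega>. indicator A (\<Xi>' \<omega>) \<partial>M) = (\<integral>\<omega>. indicator E \<omega> \<partial>M :: real)"
      by (rule Bochner_Integration.integral_cong) (auto simp: indicator_def E_iff(2))
    ultimately show ?thesis by simp
  qed
  ultimately have "prob E = 0"
    using pos by (simp add: mult_le_0_iff measure_le_0_iff)
  then have "AE \<omega> in M. \<omega> \<notin> E" 
    by (intro AE_not_in) (simp add: null_sets_def emeasure_eq_measure)
  then show ?thesis
    using AE_space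
  proof eventually_elim
    case (elim \<omega>)
    with E_iff(1)[OF elim(2)] obtain c where c: "\<And>n. lindley n (\<Xi> \<omega>) \<le> c"
      by (auto simp: A_iff bdd_above_def)
    have "- c \<le> (\<Sum>i<n. \<xi> i \<omega>)" for n
      using sum_le_lindley[of "\<Xi> \<omega>" n] c[of n] by (simp add: \<Xi>_def)
    then show ?case by (intro bdd_belowI[of _ "- c"]) auto
  qed
qed

section \<open>From integer times to real times\<close>

text \<open>If the process falls below \<open>-a - b\<close> at some grid point, stop it at the first such point \<open>j / m\<close>. Up to
  the next integer time it rises by at most \<open>b\<close> with probability at least one half, independently of the
  past, and then it is below \<open>-a\<close> at an integer time. The bound does not depend on the mesh.\<close>

lemma (in prob_space) ottaviani_grid:
  fixes Y :: "real \<Rightarrow> 'a \<Rightarrow> real"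
  assumes rv [measurable]: "\<And>t. Y t \<in> borel_measurable M"
    and Y0: "\<And>\<omega>. \<omega> \<in> space M \<Longrightarrow> Y 0 \<omega> = 0"
    and stat: "\<And>s t. 0 \<le> s \<Longrightarrow> s \<le> t \<Longrightarrow>
      distr M borel (\<lambda>\<omega>. Y t \<omega> - Y s \<omega>) = distr M borel (Y (t - s))"
    and ind: "\<And>(t :: nat \<Rightarrow> real) n. strict_mono_on {..n} t \<Longrightarrow> 0 \<le> t 0 \<Longrightarrow>
      indep_vars (\<lambda>_. borel) (\<lambda>i \<omega>. Y (t (Suc i)) \<omega> - Y (t i) \<omega>) {..<n}"
    and b: "\<And>s. s \<in> \<rat> \<Longrightarrow> 0 \<le> s \<Longrightarrow> s \<le> 1 \<Longrightarrow> 1 / 2 \<le> prob {\<omega> \<in> space M. Y s \<omega> \<le> b}"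
    and m: "0 < m"
  shows "prob {\<omega> \<in> space M. \<exists>j::nat. Y (real j / real m) \<omega> < - a - b} \<le>
    2 * prob {\<omega> \<in> space M. \<exists>n::nat. Y (real n) \<omega> < - a}"
proof -
  define A where "A j = {\<omega> \<in> space M. Y (real j / real m) \<omega> < - a - b \<and>
    (\<forall>i<j. - a - b \<le> Y (real i / real m) \<omega>)}" for j
  \<comment> \<open>The next integer time is strictly later even if \<open>j / m\<close> is an integer, so that the time grid
    extended by it is strictly increasing.\<close>
  define c where "c j = Suc (j div m)" for j
  define B where "B j = {\<omega> \<in> space M. Y (real (c j)) \<omega> - Y (real j / real m) \<omega> \<le> b}" for j
  define C where "C = {\<omega> \<in> space M. \<exists>n::nat. Y (real n) \<omega> < - a}"
  have [measurable]: "A j \<in> events" "B j \<in> events" "C \<in> events" for j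
    unfolding A_def B_def C_def by measurable
  have c: "real j / real m < real (c j)" "real (c j) - real j / real m \<le> 1" for j
  proof -
    have "j = m * (j div m) + j mod m" by simp
    then have j: "real j = real m * real (j div m) + real (j mod m)"
      by (metis of_nat_add of_nat_mult)
    moreover have "real (j mod m) < real m" using m by simp
    ultimately show "real j / real m < real (c j)" using m by (simp add: c_def field_simps)
    show "real (c j) - real j / real m \<le> 1" using m j by (simp add: c_def field_simps)
  qed
  have half: "prob (A j) \<le> 2 * prob (A j \<inter> B j)" for j
  proof -
    define t where "t i = (if i \<le> j then real i / real m else real (c j))" for i
    have mono: "strict_mono_on {..Suc j} t"
    proof (intro strict_mono_onI)
      fix r s assume "r \<in> {..Suc j}" "s \<in> {..Suc j}" "r < s"
      then show "t r < t s"
        using c(1)[of j] m divide_right_mono[of "real r" "real j" "real m"] by (auto simp: t_def divide_strict_right_mono)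
    qed
    have indt: "indep_vars (\<lambda>_. borel) (\<lambda>i \<omega>. Y (t (Suc i)) \<omega> - Y (t i) \<omega>) {..<Suc j}"
      by (rule ind[OF mono]) (simp add: t_def)
    let ?inc = "\<lambda>K \<omega>. restrict (\<lambda>i. Y (t (Suc i)) \<omega> - Y (t i) \<omega>) K"
    let ?N = "\<lambda>K. \<Pi>\<^sub>M i\<in>K. (borel :: real measure)"
    have iv: "indep_var (?N {..<j}) (?inc {..<j}) (?N {j}) (?inc {j})"
      by (rule indep_var_restrict[OF indt]) auto
    define S where "S = {x \<in> space (?N {..<j}). (\<Sum>k<j. x k) < - a - b \<and> (\<forall>i<j. - a - b \<le> (\<Sum>k<i. x k))}"
    have comp: "(\<lambda>x. x k) \<in> borel_measurable (?N {..<j})" if "k < j" for k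
      by (rule measurable_component_singleton) (use that in simp)
    have sums: "(\<lambda>x. \<Sum>k<i. x k) \<in> borel_measurable (?N {..<j})" if "i \<le> j" for i
      by (intro borel_measurable_sum comp) (use that in auto)
    have S: "S \<in> sets (?N {..<j})"
    proof -
      have "{x \<in> space (?N {..<j}). (\<Sum>k<j. x k) < - a - b} \<in> sets (?N {..<j})"
        by (intro borel_measurable_less sums) auto
      moreover have "{x \<in> space (?N {..<j}). \<forall>i\<in>{..<j}. - a - b \<le> (\<Sum>k<i. x k)} \<in> sets (?N {..<j})"
        by (intro sets.sets_Collect_finite_All borel_measurable_le sums) auto
      ultimately have "{x \<in> space (?N {..<j}). (\<Sum>k<j. x k) < - a - b} \<inter>
        {x \<in> space (?N {..<j}). \<forall>i\<in>{..<j}. - a - b \<le> (\<Sum>k<i. x k)} \<in> sets (?N {..<j})" by (rule sets.Int)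
      moreover have "S = {x \<in> space (?N {..<j}). (\<Sum>k<j. x k) < - a - b} \<inter>
        {x \<in> space (?N {..<j}). \<forall>i\<in>{..<j}. - a - b \<le> (\<Sum>k<i. x k)}" by (auto simp: S_def)
      ultimately show ?thesis by simp
    qed
    have T: "{x \<in> space (?N {j}). x j \<le> b} \<in> sets (?N {j})"
      by (intro borel_measurable_le measurable_component_singleton) auto
    have sum_inc: "(\<Sum>k<i. Y (t (Suc k)) \<omega> - Y (t k) \<omega>) = Y (real i / real m) \<omega>"
      if "i \<le> j" "\<omega> \<in> space M" for i \<omega>
      using that Y0[of \<omega>] sum_lessThan_telescope[of "\<lambda>k. Y (t k) \<omega>" i] by (simp add: t_def)
    have sp: "?inc K \<omega> \<in> space (?N K)" for K \<omega> by (simp add: space_PiM)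
    have A_eq: "A j = ?inc {..<j} -` S \<inter> space M"
      using sp by (auto simp: A_def S_def sum_inc)
    have B_eq: "B j = ?inc {j} -` {x \<in> space (?N {j}). x j \<le> b} \<inter> space M"
      using sp by (auto simp: B_def t_def)
    have "A j \<inter> B j = (\<lambda>\<omega>. (?inc {..<j} \<omega>, ?inc {j} \<omega>)) -` (S \<times> {x \<in> space (?N {j}). x j \<le> b}) \<inter> space M"
      unfolding A_eq B_eq by auto
    then have AB: "prob (A j \<inter> B j) = prob (A j) * prob (B j)"
      using indep_varD[OF iv S T] unfolding A_eq B_eq by simp
    have "prob (B j) = measure (distr M borel (\<lambda>\<omega>. Y (real (c j)) \<omega> - Y (real j / real m) \<omega>)) {..b}"
      by (subst measure_distr) (auto simp: B_def intro!: arg_cong[where f=prob])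
    also have "\<dots> = measure (distr M borel (Y (real (c j) - real j / real m))) {..b}"
      by (subst stat) (use c(1)[of j] in auto)
    also have "\<dots> = prob {\<omega> \<in> space M. Y (real (c j) - real j / real m) \<omega> \<le> b}"
      by (subst measure_distr) (auto intro!: arg_cong[where f=prob])
    finally have "1 / 2 \<le> prob (B j)"
      using b[of "real (c j) - real j / real m"] c[of j] by simp
    then have "prob (A j) * (1 / 2) \<le> prob (A j \<inter> B j)"
      unfolding AB by (intro mult_left_mono) auto
    then show ?thesis by simp
  qed
  have disj: "disjoint_family A"
    unfolding disjoint_family_on_def
  proof (intro ballI impI)
    fix i j :: nat assume "i \<noteq> j"
    then show "A i \<inter> A j = {}"
      by (cases i j rule: linorder_cases) (force simp: A_def)+
  qed
  have "(\<lambda>j. prob (A j)) sums prob (\<Union>j. A j)"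
    by (rule finite_measure_UNION[OF _ disj]) auto
  moreover have "(\<lambda>j. prob (A j \<inter> B j)) sums prob (\<Union>j. A j \<inter> B j)"
    by (rule finite_measure_UNION) (use disj in \<open>auto simp: disjoint_family_on_def\<close>)
  ultimately have "prob (\<Union>j. A j) \<le> 2 * prob (\<Union>j. A j \<inter> B j)"
    by (intro sums_le[OF half _ sums_mult])
  also have "prob (\<Union>j. A j \<inter> B j) \<le> prob C"
  proof (rule finite_measure_mono, rule subsetI)
    fix \<omega> assume "\<omega> \<in> (\<Union>j. A j \<inter> B j)"
    then obtain j where "\<omega> \<in> A j" "\<omega> \<in> B j" by blast
    then have "\<omega> \<in> space M" "Y (real (c j)) \<omega> < - a" by (auto simp: A_def B_def)
    then show "\<omega> \<in> C" unfolding C_def by blast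
  qed measurable
  finally have "prob (\<Union>j. A j) \<le> 2 * prob C" by simp
  moreover have "(\<Union>j. A j) = {\<omega> \<in> space M. \<exists>j::nat. Y (real j / real m) \<omega> < - a - b}"
  proof (intro equalityI subsetI)
    fix \<omega> assume \<omega>: "\<omega> \<in> {\<omega> \<in> space M. \<exists>j::nat. Y (real j / real m) \<omega> < - a - b}"
    let ?Q = "\<lambda>j::nat. Y (real j / real m) \<omega> < - a - b"
    have "?Q (LEAST j. ?Q j)" using \<omega> by (auto intro: LeastI_ex)
    moreover have "- a - b \<le> Y (real i / real m) \<omega>" if "i < (LEAST j. ?Q j)" for i
      using not_less_Least[OF that] by simp
    ultimately have "\<omega> \<in> A (LEAST j. ?Q j)" using \<omega> unfolding A_def by blast
    then show "\<omega> \<in> (\<Union>j. A j)" by blast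
  qed (auto simp: A_def)
  ultimately show ?thesis by (simp add: C_def)
qed

text \<open>Meshes \<open>1 / k!\<close> give nested grids that exhaust the nonnegative rationals.\<close>

lemma nonneg_Rats_fact:
  assumes "q \<in> \<rat>" "0 \<le> q"
  obtains j k :: nat where "q = real j / real (fact k)"
proof -
  obtain n d :: nat where d: "d \<noteq> 0" "\<bar>q\<bar> = real n / real d"
    using Rats_abs_nat_div_natE[OF assms(1)] by metis
  then obtain e where e: "d = Suc e" by (cases d) auto
  have "q = real n * real (fact e) / (real d * real (fact e))"
    using d(2) assms(2) by simp
  also have "\<dots> = real (n * fact e) / real (fact d)"
    unfolding e by (simp only: fact_Suc of_nat_mult of_nat_id)
  finally have "q = real (n * fact e) / real (fact d)" .
  then show ?thesis by (rule that)
qed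

lemma (in prob_space) drift_process_bounded_below:
  fixes Y :: "real \<Rightarrow> 'a \<Rightarrow> real"
  assumes rv [measurable]: "\<And>t. Y t \<in> borel_measurable M"
    and Y0: "\<And>\<omega>. \<omega> \<in> space M \<Longrightarrow> Y 0 \<omega> = 0"
    and stat: "\<And>s t. 0 \<le> s \<Longrightarrow> s \<le> t \<Longrightarrow>
      distr M borel (\<lambda>\<omega>. Y t \<omega> - Y s \<omega>) = distr M borel (Y (t - s))"
    and ind: "\<And>(t :: nat \<Rightarrow> real) n. strict_mono_on {..n} t \<Longrightarrow> 0 \<le> t 0 \<Longrightarrow>
      indep_vars (\<lambda>_. borel) (\<lambda>i \<omega>. Y (t (Suc i)) \<omega> - Y (t i) \<omega>) {..<n}"
    and b: "\<And>s. s \<in> \<rat> \<Longrightarrow> 0 \<le> s \<Longrightarrow> s \<le> 1 \<Longrightarrow> 1 / 2 \<le> prob {\<omega> \<in> space M. Y s \<omega> \<le> b}"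
    and int: "integrable M (Y 1)" and pos: "0 < expectation (Y 1)"
  shows "AE \<omega> in M. \<exists>c. \<forall>q\<in>\<rat>. 0 \<le> q \<longrightarrow> c \<le> Y q \<omega>"
proof -
  define \<xi> where "\<xi> i \<omega> = Y (real (Suc i)) \<omega> - Y (real i) \<omega>" for i :: nat and \<omega>
  have \<xi>_law: "distr M borel (\<xi> i) = distr M borel (Y 1)" for i
    unfolding \<xi>_def[abs_def] by (subst stat) auto
  have \<xi>_rv: "\<xi> i \<in> borel_measurable M" for i
    unfolding \<xi>_def[abs_def] by measurable
  have "indep_vars (\<lambda>_. borel) \<xi> UNIV"
    unfolding indep_vars_def2
  proof (intro conjI ballI)
    show "indep_sets (\<lambda>i. {\<xi> i -` A \<inter> space M |A. A \<in> sets borel}) UNIV"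
    proof (subst indep_sets_finite_index_sets, intro allI impI)
      fix J :: "nat set" assume "finite J"
      then obtain n where n: "J \<subseteq> {..<n}" by (auto simp: finite_nat_iff_bounded)
      have "indep_vars (\<lambda>_. borel) \<xi> {..<n}"
        unfolding \<xi>_def[abs_def] by (rule ind) (auto simp: strict_mono_on_def)
      then have "indep_vars (\<lambda>_. borel) \<xi> J" using n by (rule indep_vars_subset)
      then show "indep_sets (\<lambda>i. {\<xi> i -` A \<inter> space M |A. A \<in> sets borel}) J"
        by (simp add: indep_vars_def2)
    qed
  qed (rule \<xi>_rv)
  then have walk: "AE \<omega> in M. bdd_below (range (\<lambda>n. \<Sum>i<n. \<xi> i \<omega>))"
  proof (rule random_walk_bounded_below)
    show "distr M borel (\<xi> i) = distr M borel (\<xi> 0)" for i by (simp add: \<xi>_law)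
    show "integrable M (\<xi> 0)"
      using int integrable_distr_eq[OF \<xi>_rv, of "\<lambda>x. x" 0] integrable_distr_eq[OF rv, of "\<lambda>x. x" 1]
      by (simp add: \<xi>_law)
    show "0 < expectation (\<xi> 0)"
      using pos integral_distr[OF \<xi>_rv, of "\<lambda>x. x" 0] integral_distr[OF rv, of "\<lambda>x. x" 1]
      by (simp add: \<xi>_law)
  qed
  have sum_\<xi>: "(\<Sum>i<n. \<xi> i \<omega>) = Y (real n) \<omega>" if "\<omega> \<in> space M" for n \<omega>
    unfolding \<xi>_def using sum_lessThan_telescope[of "\<lambda>i. Y (real i) \<omega>" n] Y0[OF that] by simp
  define C where "C k = {\<omega> \<in> space M. \<exists>n::nat. Y (real n) \<omega> < - real k}" for k
  define F where "F k m = {\<omega> \<in> space M. \<exists>j::nat. Y (real j / real (fact m)) \<omega> < - real k - b}" for k m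
  have [measurable]: "C k \<in> events" "F k m \<in> events" for k m
    unfolding C_def F_def by measurable
  have C0: "(\<lambda>k. prob (C k)) \<longlonglongrightarrow> 0"
  proof -
    have "decseq C"
    proof (rule decseq_SucI, rule subsetI)
      fix k \<omega> assume "\<omega> \<in> C (Suc k)"
      then obtain n where "\<omega> \<in> space M" "Y (real n) \<omega> < - real (Suc k)" by (auto simp: C_def)
      then show "\<omega> \<in> C k" unfolding C_def by (auto intro!: exI[of _ n])
    qed
    then have "(\<lambda>k. prob (C k)) \<longlonglongrightarrow> prob (\<Inter>k. C k)"
      by (intro finite_Lim_measure_decseq) auto
    moreover have "prob (\<Inter>k. C k) = 0"
    proof (rule prob_eq_0[THEN iffD2])
      show "AE \<omega> in M. \<omega> \<notin> (\<Inter>k. C k)"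
        using walk AE_space
      proof eventually_elim
        case (elim \<omega>)
        then obtain c where c: "\<And>n. c \<le> Y (real n) \<omega>" by (auto simp: bdd_below_def sum_\<xi>)
        obtain k :: nat where "- c < real k" using reals_Archimedean2 by blast
        then have "- real k \<le> Y (real n) \<omega>" for n using c[of n] by simp
        then have "\<omega> \<notin> C k" by (auto simp: C_def not_less)
        then show ?case by blast
      qed
    qed auto
    ultimately show ?thesis by simp
  qed
  have F_le: "prob (\<Union>m. F k m) \<le> 2 * prob (C k)" for k
  proof -
    have "incseq (F k)"
    proof (rule incseq_SucI, rule subsetI)
      fix m \<omega> assume "\<omega> \<in> F k m"
      then obtain j :: nat where "\<omega> \<in> space M" "Y (real j / real (fact m)) \<omega> < - real k - b"
        by (auto simp: F_def)
      moreover have "real j / real (fact m) = real (j * Suc m) / real (fact (Suc m))"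
        by (simp only: fact_Suc of_nat_mult of_nat_id) (simp del: of_nat_Suc)
      ultimately show "\<omega> \<in> F k (Suc m)" unfolding F_def by (metis (mono_tags, lifting) mem_Collect_eq)
    qed
    then have "(\<lambda>m. prob (F k m)) \<longlonglongrightarrow> prob (\<Union>m. F k m)"
      by (intro finite_Lim_measure_incseq) auto
    moreover have "prob (F k m) \<le> 2 * prob (C k)" for m
      unfolding F_def C_def by (rule ottaviani_grid[OF rv Y0 stat ind b]) auto
    ultimately show ?thesis by (intro LIMSEQ_le_const2) auto
  qed
  have "prob (\<Inter>k. \<Union>m. F k m) \<le> 2 * prob (C k)" for k
    by (rule order_trans[OF finite_measure_mono F_le]) auto
  then have "prob (\<Inter>k. \<Union>m. F k m) \<le> 2 * 0"
    by (intro LIMSEQ_le_const[OF tendsto_mult[OF tendsto_const C0]]) auto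
  then have "prob (\<Inter>k. \<Union>m. F k m) = 0" by (simp add: measure_le_0_iff)
  then have "AE \<omega> in M. \<omega> \<notin> (\<Inter>k. \<Union>m. F k m)" by (subst (asm) prob_eq_0) auto
  then show ?thesis
    using AE_space
  proof eventually_elim
    case (elim \<omega>)
    then obtain k where k: "\<omega> \<notin> (\<Union>m. F k m)" by blast
    have "- real k - b \<le> Y q \<omega>" if q: "q \<in> \<rat>" "0 \<le> q" for q
    proof -
      obtain j m :: nat where "q = real j / real (fact m)" using nonneg_Rats_fact[OF q] .
      with k elim(2) show ?thesis by (auto simp: F_def not_less)
    qed
    then show ?case by blast
  qed
qed

section \<open>The contact set is unbounded in both directions\<close>

lemma cadlag_bounded_above:
  assumes "cadlag f" "compact K"
  obtains c where "\<And>s. s \<in> K \<Longrightarrow> f s \<le> c"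
proof (rule ccontr)
  assume no: "\<not> thesis"
  have neg: "cadlag (\<lambda>t. - f t)"
    using assms(1) unfolding cadlag_def by (auto intro!: continuous_minus tendsto_minus)
  have "\<exists>s\<in>K. real n < f s" for n
    using no that by (meson not_le)
  then obtain q where q: "\<And>n. q n \<in> K" "\<And>n. real n < f (q n)" by metis
  then obtain t r where tr: "strict_mono (r :: nat \<Rightarrow> nat)" "(q \<circ> r) \<longlonglongrightarrow> t"
    using assms(2) unfolding compact_def by metis
  have "eventually (\<lambda>n. min_left_limit (\<lambda>t. - f t) t - 1 < - f (q (r n))) sequentially"
    using eventually_compose_filterlim[OF eventually_gt_min_left_limit[OF neg, of "min_left_limit (\<lambda>t. - f t) t - 1" t] tr(2)]
    by simp
  moreover have "eventually (\<lambda>n. real n > 1 - min_left_limit (\<lambda>t. - f t) t) sequentially"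
    using filterlim_at_top_dense filterlim_real_sequentially by blast
  ultimately have "eventually (\<lambda>n. False) sequentially"
  proof eventually_elim
    case (elim n)
    have "real n \<le> real (r n)" using seq_suble[OF tr(1), of n] by simp
    with elim q(2)[of "r n"] show ?case by linarith
  qed
  then show False by simp
qed

lemma (in prob_space) distr_affine_eq:
  fixes f g :: "'a \<Rightarrow> real"
  assumes [measurable]: "f \<in> borel_measurable M" "g \<in> borel_measurable M"
    and "distr M borel f = distr M borel g"
  shows "distr M borel (\<lambda>\<omega>. c * f \<omega> + d) = distr M borel (\<lambda>\<omega>. c * g \<omega> + d)"
proof -
  have "distr M borel (\<lambda>\<omega>. c * h \<omega> + d) = distr (distr M borel h) borel (\<lambda>x. c * x + d)"
    if "h \<in> borel_measurable M" for h
    by (subst distr_distr) (use that in \<open>auto simp: comp_def\<close>)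
  with assms show ?thesis by simp
qed

context two_sided_levy
begin

declare random_variable_X [measurable]

text \<open>Tightness on a compact time interval: the supremum of each path there is finite.\<close>

lemma median_bound:
  obtains b where "\<And>s. s \<in> \<rat> \<Longrightarrow> \<bar>s\<bar> \<le> 1 \<Longrightarrow> 1 / 2 \<le> prob {\<omega> \<in> space P. X s \<omega> \<le> b}"
proof -
  define E where "E n = {\<omega> \<in> space P. \<exists>q. \<bar>real_of_rat q\<bar> \<le> 1 \<and> real n < X (real_of_rat q) \<omega>}" for n :: nat
  have [measurable]: "E n \<in> events" for n unfolding E_def by measurable
  have "decseq E"
  proof (rule decseq_SucI, rule subsetI)
    fix n \<omega> assume "\<omega> \<in> E (Suc n)"
    then obtain q where "\<omega> \<in> space P" "\<bar>real_of_rat q\<bar> \<le> 1" "real (Suc n) < X (real_of_rat q) \<omega>"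
      by (auto simp: E_def)
    then show "\<omega> \<in> E n" unfolding E_def by (auto intro!: exI[of _ q])
  qed
  then have "(\<lambda>n. prob (E n)) \<longlonglongrightarrow> prob (\<Inter>n. E n)"
    by (intro finite_Lim_measure_decseq) auto
  moreover have "(\<Inter>n. E n) = {}"
  proof -
    have "\<omega> \<notin> (\<Inter>n. E n)" if \<omega>: "\<omega> \<in> space P" for \<omega>
    proof -
      obtain c where c: "\<And>s. s \<in> {-1..1} \<Longrightarrow> X s \<omega> \<le> c"
        using cadlag_bounded_above[OF cadlag_paths[OF \<omega>], of "{-1..1}"] by blast
      obtain n :: nat where "c < real n" using reals_Archimedean2 by blast
      moreover have "X s \<omega> \<le> c" if "\<bar>s\<bar> \<le> 1" for s
        by (rule c) (use that in \<open>simp add: abs_le_iff\<close>)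
      ultimately have "X s \<omega> \<le> real n" if "\<bar>s\<bar> \<le> 1" for s
        using that by (meson less_imp_le order_trans)
      then have "\<omega> \<notin> E n" by (auto simp: E_def not_less)
      then show ?thesis by blast
    qed
    moreover have "(\<Inter>n. E n) \<subseteq> space P" by (auto simp: E_def)
    ultimately show ?thesis by blast
  qed
  ultimately have "(\<lambda>n. prob (E n)) \<longlonglongrightarrow> 0" by simp
  then have "eventually (\<lambda>n. prob (E n) < 1 / 2) sequentially"
    by (rule order_tendstoD) simp
  then obtain n where n: "prob (E n) < 1 / 2" by (auto simp: eventually_sequentially)
  have "1 / 2 \<le> prob {\<omega> \<in> space P. X s \<omega> \<le> real n}" if s: "s \<in> \<rat>" "\<bar>s\<bar> \<le> 1" for s
  proof -
    obtain q where q: "s = real_of_rat q" using s(1) by (rule Rats_cases)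
    have "1 / 2 \<le> prob (space P - E n)" using n by (simp add: prob_compl)
    also have "\<dots> \<le> prob {\<omega> \<in> space P. X s \<omega> \<le> real n}"
      by (rule finite_measure_mono) (use q s(2) in \<open>auto simp: E_def not_less\<close>)
    finally show ?thesis .
  qed
  then show ?thesis by (rule that)
qed

lemma forward_bounded_below:
  assumes int: "integrable P (X 1)" and \<beta>: "- expectation (X 1) < \<beta>"
  shows "AE \<omega> in P. \<exists>c. \<forall>q\<in>\<rat>. 0 \<le> q \<longrightarrow> c \<le> X q \<omega> + \<beta> * q"
proof -
  obtain b where b: "\<And>s. s \<in> \<rat> \<Longrightarrow> \<bar>s\<bar> \<le> 1 \<Longrightarrow> 1 / 2 \<le> prob {\<omega> \<in> space P. X s \<omega> \<le> b}"
    using median_bound by blast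
  show ?thesis
  proof (rule drift_process_bounded_below[where b="b + \<bar>\<beta>\<bar>"])
    show "(\<lambda>\<omega>. X t \<omega> + \<beta> * t) \<in> borel_measurable P" for t by measurable
    show "X 0 \<omega> + \<beta> * 0 = 0" if "\<omega> \<in> space P" for \<omega> using X_zero[OF that] by simp
    show "distr P borel (\<lambda>\<omega>. X t \<omega> + \<beta> * t - (X s \<omega> + \<beta> * s)) =
        distr P borel (\<lambda>\<omega>. X (t - s) \<omega> + \<beta> * (t - s))" if "0 \<le> s" "s \<le> t" for s t
    proof -
      have "distr P borel (\<lambda>\<omega>. X t \<omega> - X s \<omega>) = distr P borel (\<lambda>\<omega>. X (t - s) \<omega> - X 0 \<omega>)"
        using stationary_increments[of 0 "t - s" s] that by simp
      then have "distr P borel (\<lambda>\<omega>. 1 * (X t \<omega> - X s \<omega>) + \<beta> * (t - s)) =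
          distr P borel (\<lambda>\<omega>. 1 * (X (t - s) \<omega> - X 0 \<omega>) + \<beta> * (t - s))"
        by (rule distr_affine_eq[rotated 2]) auto
      also have "(\<lambda>\<omega>. 1 * (X t \<omega> - X s \<omega>) + \<beta> * (t - s)) = (\<lambda>\<omega>. X t \<omega> + \<beta> * t - (X s \<omega> + \<beta> * s))"
        by (auto simp: algebra_simps)
      also have "distr P borel (\<lambda>\<omega>. 1 * (X (t - s) \<omega> - X 0 \<omega>) + \<beta> * (t - s)) =
          distr P borel (\<lambda>\<omega>. X (t - s) \<omega> + \<beta> * (t - s))"
        by (rule distr_cong) (auto simp: X_zero)
      finally show ?thesis .
    qed
    show "indep_vars (\<lambda>_. borel) (\<lambda>i \<omega>. X (t (Suc i)) \<omega> + \<beta> * t (Suc i) - (X (t i) \<omega> + \<beta> * t i)) {..<n}"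
      if "strict_mono_on {..n} t" for t :: "nat \<Rightarrow> real" and n
    proof -
      have "indep_vars (\<lambda>_. borel) (\<lambda>i \<omega>. (X (t (Suc i)) \<omega> - X (t i) \<omega>) + \<beta> * (t (Suc i) - t i)) {..<n}"
        by (rule indep_vars_compose2[OF independent_increments[OF that]]) auto
      then show ?thesis by (simp add: algebra_simps)
    qed
    show "1 / 2 \<le> prob {\<omega> \<in> space P. X s \<omega> + \<beta> * s \<le> b + \<bar>\<beta>\<bar>}" if "s \<in> \<rat>" "0 \<le> s" "s \<le> 1" for s
    proof -
      have "\<beta> * s \<le> \<bar>\<beta>\<bar> * s" using that by (intro mult_right_mono) auto
      also have "\<dots> \<le> \<bar>\<beta>\<bar> * 1" using that by (intro mult_left_mono) auto
      finally have "{\<omega> \<in> space P. X s \<omega> \<le> b} \<subseteq> {\<omega> \<in> space P. X s \<omega> + \<beta> * s \<le> b + \<bar>\<beta>\<bar>}" by auto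
      then have "prob {\<omega> \<in> space P. X s \<omega> \<le> b} \<le> prob {\<omega> \<in> space P. X s \<omega> + \<beta> * s \<le> b + \<bar>\<beta>\<bar>}"
        by (rule finite_measure_mono) measurable
      with b[of s] that show ?thesis by simp
    qed
    show "integrable P (\<lambda>\<omega>. X 1 \<omega> + \<beta> * 1)" using int by simp
    show "0 < expectation (\<lambda>\<omega>. X 1 \<omega> + \<beta> * 1)" using int \<beta> by (simp add: prob_space)
  qed
qed

text \<open>Reversed time is treated directly and not by passing to a time-reversed process, whose paths
  would be left-continuous: the bound for processes with drift asks nothing of the paths.\<close>

lemma backward_bounded_below:
  assumes int: "integrable P (X 1)" and \<beta>: "expectation (X 1) < \<beta>"
  shows "AE \<omega> in P. \<exists>c. \<forall>q\<in>\<rat>. 0 \<le> q \<longrightarrow> c \<le> X (- q) \<omega> + \<beta> * q"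
proof -
  obtain b where b: "\<And>s. s \<in> \<rat> \<Longrightarrow> \<bar>s\<bar> \<le> 1 \<Longrightarrow> 1 / 2 \<le> prob {\<omega> \<in> space P. X s \<omega> \<le> b}"
    using median_bound by blast
  have minus_one: "distr P borel (X (- 1)) = distr P borel (\<lambda>\<omega>. - X 1 \<omega>)"
  proof -
    have "distr P borel (\<lambda>\<omega>. X 0 \<omega> - X (- 1) \<omega>) = distr P borel (\<lambda>\<omega>. X 1 \<omega> - X 0 \<omega>)"
      using stationary_increments[of 0 1 "-1"] by simp
    then have "distr P borel (\<lambda>\<omega>. - 1 * (X 0 \<omega> - X (- 1) \<omega>) + 0) = distr P borel (\<lambda>\<omega>. - 1 * (X 1 \<omega> - X 0 \<omega>) + 0)"
      by (rule distr_affine_eq[rotated 2]) auto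
    moreover have "distr P borel (\<lambda>\<omega>. - 1 * (X 0 \<omega> - X (- 1) \<omega>) + 0) = distr P borel (X (- 1))"
      "distr P borel (\<lambda>\<omega>. - 1 * (X 1 \<omega> - X 0 \<omega>) + 0) = distr P borel (\<lambda>\<omega>. - X 1 \<omega>)"
      by (rule distr_cong; auto simp: X_zero)+
    ultimately show ?thesis by simp
  qed
  have neg_int: "integrable P (\<lambda>\<omega>. - X 1 \<omega>)" using int by simp
  have rv1: "X (- 1) \<in> borel_measurable P" "(\<lambda>\<omega>. - X 1 \<omega>) \<in> borel_measurable P" by measurable
  have int1: "integrable P (X (- 1))"
  proof -
    have "integrable (distr P borel (X (- 1))) (\<lambda>x. x)"
      unfolding minus_one by (subst integrable_distr_eq[OF rv1(2)]) (use neg_int in auto)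
    then show ?thesis by (subst (asm) integrable_distr_eq[OF rv1(1)]) auto
  qed
  have exp1: "expectation (X (- 1)) = - expectation (X 1)"
  proof -
    have "expectation (X (- 1)) = integral\<^sup>L (distr P borel (X (- 1))) (\<lambda>x. x)"
      by (rule integral_distr[OF rv1(1), symmetric]) simp
    also have "\<dots> = expectation (\<lambda>\<omega>. - X 1 \<omega>)"
      unfolding minus_one by (rule integral_distr[OF rv1(2)]) simp
    finally show ?thesis by simp
  qed
  show ?thesis
  proof (rule drift_process_bounded_below[where b="b + \<bar>\<beta>\<bar>"])
    show "(\<lambda>\<omega>. X (- t) \<omega> + \<beta> * t) \<in> borel_measurable P" for t by measurable
    show "X (- 0) \<omega> + \<beta> * 0 = 0" if "\<omega> \<in> space P" for \<omega> using X_zero[OF that] by simp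
    show "distr P borel (\<lambda>\<omega>. X (- t) \<omega> + \<beta> * t - (X (- s) \<omega> + \<beta> * s)) =
        distr P borel (\<lambda>\<omega>. X (- (t - s)) \<omega> + \<beta> * (t - s))" if "0 \<le> s" "s \<le> t" for s t
    proof -
      have "distr P borel (\<lambda>\<omega>. X (- s) \<omega> - X (- t) \<omega>) = distr P borel (\<lambda>\<omega>. X 0 \<omega> - X (s - t) \<omega>)"
        using stationary_increments[of "s - t" 0 "- s"] that by simp
      then have "distr P borel (\<lambda>\<omega>. - 1 * (X (- s) \<omega> - X (- t) \<omega>) + \<beta> * (t - s)) =
          distr P borel (\<lambda>\<omega>. - 1 * (X 0 \<omega> - X (s - t) \<omega>) + \<beta> * (t - s))"
        by (rule distr_affine_eq[rotated 2]) auto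
      also have "(\<lambda>\<omega>. - 1 * (X (- s) \<omega> - X (- t) \<omega>) + \<beta> * (t - s)) =
          (\<lambda>\<omega>. X (- t) \<omega> + \<beta> * t - (X (- s) \<omega> + \<beta> * s))"
        by (auto simp: algebra_simps)
      also have "distr P borel (\<lambda>\<omega>. - 1 * (X 0 \<omega> - X (s - t) \<omega>) + \<beta> * (t - s)) =
          distr P borel (\<lambda>\<omega>. X (- (t - s)) \<omega> + \<beta> * (t - s))"
        by (rule distr_cong) (auto simp: X_zero)
      finally show ?thesis .
    qed
    show "indep_vars (\<lambda>_. borel) (\<lambda>i \<omega>. X (- t (Suc i)) \<omega> + \<beta> * t (Suc i) - (X (- t i) \<omega> + \<beta> * t i)) {..<n}"
      if t: "strict_mono_on {..n} t" for t :: "nat \<Rightarrow> real" and n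
    proof -
      \<comment> \<open>The increments along the negative times are the increments along the reversed sequence, taken in
        reverse order.\<close>
      have "strict_mono_on {..n} (\<lambda>j. - t (n - j))"
        using t by (auto simp: strict_mono_on_def)
      from independent_increments[OF this]
      have ind: "indep_vars (\<lambda>_. borel) (\<lambda>j \<omega>. X (- t (n - Suc j)) \<omega> - X (- t (n - j)) \<omega>) {..<n}" .
      have img: "(\<lambda>i. n - Suc i) ` {..<n} = {..<n}"
      proof (intro equalityI subsetI)
        fix i assume "i \<in> {..<n}"
        then show "i \<in> (\<lambda>i. n - Suc i) ` {..<n}" by (intro image_eqI[of _ _ "n - Suc i"]) auto
      qed auto
      have "indep_vars (\<lambda>_. borel) (\<lambda>i \<omega>. X (- t (n - Suc (n - Suc i))) \<omega> - X (- t (n - (n - Suc i))) \<omega>) {..<n}"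
        by (rule indep_vars_reindex[where f="\<lambda>i. n - Suc i" and N="\<lambda>_. borel"
              and X="\<lambda>j \<omega>. X (- t (n - Suc j)) \<omega> - X (- t (n - j)) \<omega>"])
          (auto simp: img inj_on_def ind)
      then have "indep_vars (\<lambda>_. borel) (\<lambda>i \<omega>. X (- t i) \<omega> - X (- t (Suc i)) \<omega>) {..<n}"
        by (rule indep_vars_cong[THEN iffD1, rotated 3]) (auto simp: Suc_diff_Suc)
      then have "indep_vars (\<lambda>_. borel) (\<lambda>i \<omega>. - (X (- t i) \<omega> - X (- t (Suc i)) \<omega>) + \<beta> * (t (Suc i) - t i)) {..<n}"
        by (rule indep_vars_compose2) auto
      then show ?thesis by (simp add: algebra_simps)
    qed
    show "1 / 2 \<le> prob {\<omega> \<in> space P. X (- s) \<omega> + \<beta> * s \<le> b + \<bar>\<beta>\<bar>}" if "s \<in> \<rat>" "0 \<le> s" "s \<le> 1" for s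
    proof -
      have "\<beta> * s \<le> \<bar>\<beta>\<bar> * s" using that by (intro mult_right_mono) auto
      also have "\<dots> \<le> \<bar>\<beta>\<bar> * 1" using that by (intro mult_left_mono) auto
      finally have "{\<omega> \<in> space P. X (- s) \<omega> \<le> b} \<subseteq> {\<omega> \<in> space P. X (- s) \<omega> + \<beta> * s \<le> b + \<bar>\<beta>\<bar>}" by auto
      then have "prob {\<omega> \<in> space P. X (- s) \<omega> \<le> b} \<le> prob {\<omega> \<in> space P. X (- s) \<omega> + \<beta> * s \<le> b + \<bar>\<beta>\<bar>}"
        by (rule finite_measure_mono) measurable
      with b[of "- s"] that show ?thesis by simp
    qed
    show "integrable P (\<lambda>\<omega>. X (- 1) \<omega> + \<beta> * 1)" using int1 by simp
    show "0 < expectation (\<lambda>\<omega>. X (- 1) \<omega> + \<beta> * 1)" using int1 \<beta> exp1 by (simp add: prob_space)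
  qed
qed

lemma contact_set_nonempty_AE:
  assumes "0 < \<alpha>" "integrable P (X 1)" "\<bar>expectation (X 1)\<bar> < \<alpha>"
  shows "AE \<omega> in P. contact_set \<alpha> (sample_path \<omega>) \<noteq> {}"
proof -
  obtain \<beta> where \<beta>: "\<bar>expectation (X 1)\<bar> < \<beta>" "\<beta> < \<alpha>" using dense[OF assms(3)] by blast
  have "AE \<omega> in P. \<exists>c. \<forall>q\<in>\<rat>. 0 \<le> q \<longrightarrow> c \<le> X q \<omega> + \<beta> * q"
    by (rule forward_bounded_below) (use assms \<beta> in auto)
  moreover have "AE \<omega> in P. \<exists>c. \<forall>q\<in>\<rat>. 0 \<le> q \<longrightarrow> c \<le> X (- q) \<omega> + \<beta> * q"
    by (rule backward_bounded_below) (use assms \<beta> in auto)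
  ultimately show ?thesis using AE_space
  proof eventually_elim
    case (elim \<omega>)
    from elim(1) obtain c1 where c1: "\<And>q. q \<in> \<rat> \<Longrightarrow> 0 \<le> q \<Longrightarrow> c1 \<le> X q \<omega> + \<beta> * q" by blast
    from elim(2) obtain c2 where c2: "\<And>q. q \<in> \<rat> \<Longrightarrow> 0 \<le> q \<Longrightarrow> c2 \<le> X (- q) \<omega> + \<beta> * q" by blast
    show ?case
    proof (rule contact_set_nonempty[OF assms(1) cadlag_paths[OF elim(3)] \<beta>(2), of "min c1 c2"])
      fix q :: real assume "q \<in> \<rat>"
      then show "min c1 c2 \<le> X q \<omega> + \<beta> * \<bar>q\<bar>"
        using c1[of q] c2[of "- q"] by (cases "0 \<le> q") auto
    qed
  qed
qed

lemma contact_set_sample_path_recentre: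
  "0 < \<alpha> \<Longrightarrow> \<omega> \<in> space P \<Longrightarrow> contact_set \<alpha> (recentre r (sample_path \<omega>)) = (\<lambda>t. t - r) ` contact_set \<alpha> (sample_path \<omega>)"
  by (rule contact_set_recentre[OF _ cadlag_paths])

lemma emeasure_stationary:
  assumes "{f \<in> space path_space. Q f} \<in> sets path_space"
  shows "emeasure P {\<omega> \<in> space P. Q (recentre r (sample_path \<omega>))} = emeasure P {\<omega> \<in> space P. Q (sample_path \<omega>)}"
proof -
  let ?B = "{f \<in> space path_space. Q f}"
  have meas: "(\<lambda>\<omega>. recentre r (sample_path \<omega>)) \<in> P \<rightarrow>\<^sub>M path_space" by measurable
  have *: "emeasure P {\<omega> \<in> space P. Q (F \<omega>)} = emeasure (distr P path_space F) ?B"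
    if "F \<in> P \<rightarrow>\<^sub>M path_space" for F
    unfolding emeasure_distr[OF that assms]
    by (rule arg_cong[where f="emeasure P"]) (use measurable_space[OF that] in auto)
  show ?thesis unfolding *[OF meas] *[OF measurable_sample_path] sample_path_stationary ..
qed

text \<open>By stationarity the probability of no contact before \<open>r\<close> is the same for all \<open>r\<close>. As \<open>r\<close> increases
  to infinity these events decrease to the null event of no contact at all.\<close>

lemma contact_set_unbounded_AE:
  assumes \<alpha>: "0 < \<alpha>" and ne: "AE \<omega> in P. contact_set \<alpha> (sample_path \<omega>) \<noteq> {}"
  shows "AE \<omega> in P. \<forall>r. contact_set \<alpha> (sample_path \<omega>) \<inter> {..<r} \<noteq> {} \<and> contact_set \<alpha> (sample_path \<omega>) \<inter> {r<..} \<noteq> {}"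
proof -
  let ?Z = "\<lambda>\<omega>. contact_set \<alpha> (sample_path \<omega>)"
  define L where "L r = {\<omega> \<in> space P. ?Z \<omega> \<inter> {..<r} = {}}" for r
  define R where "R r = {\<omega> \<in> space P. ?Z \<omega> \<inter> {r<..} = {}}" for r
  have "(\<lambda>t. t - r) ` C \<inter> {..<0} = {} \<longleftrightarrow> C \<inter> {..<r} = {}"
    "(\<lambda>t. t - r) ` C \<inter> {0<..} = {} \<longleftrightarrow> C \<inter> {r<..} = {}" for C :: "real set" and r
    by auto
  note translate = this
  have LR_shift: "L r = {\<omega> \<in> space P. contact_set \<alpha> (recentre r (sample_path \<omega>)) \<inter> {..<0} = {}}"
    "R r = {\<omega> \<in> space P. contact_set \<alpha> (recentre r (sample_path \<omega>)) \<inter> {0<..} = {}}" for r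
    unfolding L_def R_def
    by (intro Collect_cong conj_cong refl; simp only: contact_set_sample_path_recentre[OF \<alpha>] translate)+
  have sh: "(\<lambda>\<omega>. recentre r (sample_path \<omega>)) \<in> P \<rightarrow>\<^sub>M path_space" for r by measurable
  have [measurable]: "L r \<in> events" "R r \<in> events" for r
    unfolding LR_shift
    using measurable_sets_Collect[OF sh measurable_contact_set_misses(1)[OF \<alpha>]]
      measurable_sets_Collect[OF sh measurable_contact_set_misses(2)[OF \<alpha>]] by auto
  have const: "prob (L r) = prob (L 0)" "prob (R r) = prob (R 0)" for r
    using emeasure_stationary[OF measurable_contact_set_misses(1)[OF \<alpha>], of r]
      emeasure_stationary[OF measurable_contact_set_misses(1)[OF \<alpha>], of 0]
      emeasure_stationary[OF measurable_contact_set_misses(2)[OF \<alpha>], of r]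
      emeasure_stationary[OF measurable_contact_set_misses(2)[OF \<alpha>], of 0]
    unfolding LR_shift measure_def by simp_all
  have "decseq (\<lambda>n. L (real n))"
    by (rule decseq_SucI) (force simp: L_def)
  then have "(\<lambda>n. prob (L (real n))) \<longlonglongrightarrow> prob (\<Inter>n. L (real n))"
    by (intro finite_Lim_measure_decseq) auto
  then have "prob (L 0) = prob (\<Inter>n. L (real n))"
    unfolding const(1)[of "real _"] by (simp add: LIMSEQ_const_iff)
  also have "\<dots> = 0"
  proof (rule prob_eq_0[THEN iffD2])
    show "AE \<omega> in P. \<omega> \<notin> (\<Inter>n. L (real n))"
      using ne
    proof eventually_elim
      case (elim \<omega>)
      then obtain z where "z \<in> ?Z \<omega>" by auto
      moreover obtain n :: nat where "z < real n" using reals_Archimedean2 by blast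
      ultimately have "\<omega> \<notin> L (real n)" by (auto simp: L_def)
      then show ?case by blast
    qed
  qed auto
  finally have L0: "prob (L r) = 0" for r using const(1)[of r] by simp
  have "decseq (\<lambda>n. R (- real n))"
    by (rule decseq_SucI) (force simp: R_def)
  then have "(\<lambda>n. prob (R (- real n))) \<longlonglongrightarrow> prob (\<Inter>n. R (- real n))"
    by (intro finite_Lim_measure_decseq) auto
  then have "prob (R 0) = prob (\<Inter>n. R (- real n))"
    unfolding const(2)[of "- real _"] by (simp add: LIMSEQ_const_iff)
  also have "\<dots> = 0"
  proof (rule prob_eq_0[THEN iffD2])
    show "AE \<omega> in P. \<omega> \<notin> (\<Inter>n. R (- real n))"
      using ne
    proof eventually_elim
      case (elim \<omega>)
      then obtain z where "z \<in> ?Z \<omega>" by auto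
      moreover obtain n :: nat where "- z < real n" using reals_Archimedean2 by blast
      ultimately have "\<omega> \<notin> R (- real n)" by (force simp: R_def)
      then show ?case by blast
    qed
  qed auto
  finally have R0: "prob (R r) = 0" for r using const(2)[of r] by simp
  have "AE \<omega> in P. \<forall>k::int. \<omega> \<notin> L (real_of_int k) \<and> \<omega> \<notin> R (real_of_int k)"
    unfolding AE_all_countable using L0 R0 by (auto simp: prob_eq_0)
  then show ?thesis
    using AE_space
  proof eventually_elim
    case (elim \<omega>)
    show ?case
    proof (intro allI conjI)
      fix r :: real
      obtain z where z: "z \<in> ?Z \<omega>" "z < real_of_int \<lfloor>r\<rfloor>" using elim by (auto simp: L_def)
      have "z < r" using z(2) of_int_floor_le[of r] by (rule less_le_trans)
      with z(1) show "?Z \<omega> \<inter> {..<r} \<noteq> {}" by (auto simp: disjoint_iff)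
      obtain y where y: "y \<in> ?Z \<omega>" "real_of_int \<lceil>r\<rceil> < y" using elim by (auto simp: R_def)
      have "r < y" using le_of_int_ceiling[of r] y(2) by (rule le_less_trans)
      with y(1) show "?Z \<omega> \<inter> {r<..} \<noteq> {}" by (auto simp: disjoint_iff)
    qed
  qed
qed

end

section \<open>Averaging over the gap that contains the origin\<close>

lemma nn_integral_gap_fraction:
  assumes "g < d" and [measurable]: "A \<in> sets borel"
  shows "(\<integral>\<^sup>+r. indicator {g<..<d} r * indicator A ((r - g) / (d - g)) \<partial>lborel) =
    ennreal (d - g) * emeasure lborel (A \<inter> {0<..<1})"
proof -
  have "(\<integral>\<^sup>+r. indicator {g<..<d} r * indicator A ((r - g) / (d - g)) \<partial>lborel) =
    ennreal \<bar>d - g\<bar> * (\<integral>\<^sup>+x. indicator {g<..<d} (g + (d - g) * x) * indicator A ((g + (d - g) * x - g) / (d - g)) \<partial>lborel)"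
    by (rule nn_integral_real_affine) (use assms in \<open>auto\<close>)
  also have "(\<integral>\<^sup>+x. indicator {g<..<d} (g + (d - g) * x) * indicator A ((g + (d - g) * x - g) / (d - g)) \<partial>lborel)
    = (\<integral>\<^sup>+x. indicator (A \<inter> {0<..<1}) x \<partial>lborel)"
  proof (rule nn_integral_cong)
    fix x :: real
    have "g + (d - g) * x \<in> {g<..<d} \<longleftrightarrow> x \<in> {0<..<1}"
    proof -
      have "g + (d - g) * x < d \<longleftrightarrow> (d - g) * x < (d - g) * 1" by (simp add: algebra_simps)
      also have "\<dots> \<longleftrightarrow> x < 1" using assms(1) by (intro mult_less_cancel_left_pos) simp
      finally show ?thesis using assms(1) by (simp add: zero_less_mult_iff)
    qed
    then show "indicator {g<..<d} (g + (d - g) * x) * indicator A ((g + (d - g) * x - g) / (d - g)) =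
        (indicator (A \<inter> {0<..<1}) x :: ennreal)"
      using assms(1) by (auto simp: indicator_def)
  qed
  finally show ?thesis using assms(1) by simp
qed

lemma ennreal_mult_divide_cancel:
  assumes "0 < x"
  shows "ennreal x * (c / ennreal x) = c"
proof -
  have "ennreal x * inverse (ennreal x) = 1"
    using assms by (simp add: inverse_ennreal ennreal_mult[symmetric])
  then have "(ennreal x * inverse (ennreal x)) * c = c" by simp
  then show ?thesis by (simp add: divide_ennreal_def mult_ac)
qed

context two_sided_levy
begin

lemma nn_integral_stationary_lborel:
  assumes K: "K \<in> borel_measurable (path_space \<Otimes>\<^sub>M lborel)"
  shows "(\<integral>\<^sup>+\<omega>. \<integral>\<^sup>+r. K (sample_path \<omega>, r) \<partial>lborel \<partial>P) =
    (\<integral>\<^sup>+\<omega>. \<integral>\<^sup>+r. K (recentre r (sample_path \<omega>), r) \<partial>lborel \<partial>P)"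
proof -
  interpret pair_sigma_finite P lborel ..
  have "(\<lambda>p. (sample_path (fst p), snd p)) \<in> P \<Otimes>\<^sub>M lborel \<rightarrow>\<^sub>M path_space \<Otimes>\<^sub>M lborel"
    by measurable
  from measurable_compose[OF this K]
  have 1: "(\<lambda>p. K (sample_path (fst p), snd p)) \<in> borel_measurable (P \<Otimes>\<^sub>M lborel)" .
  have "(\<lambda>p. (recentre (snd p) (sample_path (fst p)), snd p)) \<in> P \<Otimes>\<^sub>M lborel \<rightarrow>\<^sub>M path_space \<Otimes>\<^sub>M lborel"
    by measurable
  from measurable_compose[OF this K]
  have 2: "(\<lambda>p. K (recentre (snd p) (sample_path (fst p)), snd p)) \<in> borel_measurable (P \<Otimes>\<^sub>M lborel)" .
  have slice: "(\<lambda>f. K (f, r)) \<in> borel_measurable path_space" for r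
    by (rule measurable_compose[OF _ K]) measurable
  have "(\<integral>\<^sup>+\<omega>. \<integral>\<^sup>+r. K (sample_path \<omega>, r) \<partial>lborel \<partial>P) = (\<integral>\<^sup>+r. \<integral>\<^sup>+\<omega>. K (sample_path \<omega>, r) \<partial>P \<partial>lborel)"
    using Fubini[OF 1] by simp
  also have "\<dots> = (\<integral>\<^sup>+r. \<integral>\<^sup>+\<omega>. K (recentre r (sample_path \<omega>), r) \<partial>P \<partial>lborel)"
    by (rule nn_integral_cong) (rule nn_integral_stationary[OF slice, symmetric])
  also have "\<dots> = (\<integral>\<^sup>+\<omega>. \<integral>\<^sup>+r. K (recentre r (sample_path \<omega>), r) \<partial>lborel \<partial>P)"
    using Fubini[OF 2] by simp
  finally show ?thesis .
qed

text \<open>The probability that the origin is a contact point is the expected Lebesgue measure of the contact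
  set within \<open>[0, 1]\<close>.\<close>

lemma zero_not_contact_AE:
  assumes \<alpha>: "0 < \<alpha>" and cnt: "AE \<omega> in P. countable (contact_set \<alpha> (sample_path \<omega>))"
  shows "AE \<omega> in P. 0 \<notin> contact_set \<alpha> (sample_path \<omega>)"
proof -
  define B where "B = {f \<in> space path_space. contact_set \<alpha> f \<inter> {0..0} \<noteq> {}}"
  have B: "B \<in> sets path_space"
    unfolding B_def pred_def[symmetric] by (rule measurable_contact_set_hits[OF \<alpha>])
  have B_iff: "f \<in> B \<longleftrightarrow> 0 \<in> contact_set \<alpha> f" if "cadlag f" for f
    using that by (auto simp: B_def)
  let ?K = "\<lambda>(f, r). indicator B f * indicator {0..1 :: real} r :: ennreal"
  have K: "?K \<in> borel_measurable (path_space \<Otimes>\<^sub>M lborel)" using B by measurable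
  have m: "{\<omega> \<in> space P. sample_path \<omega> \<in> B} \<in> events"
    using measurable_sets[OF measurable_sample_path B] by (simp add: vimage_def Int_def conj_commute)
  have "emeasure P {\<omega> \<in> space P. sample_path \<omega> \<in> B} = (\<integral>\<^sup>+\<omega>. indicator B (sample_path \<omega>) \<partial>P)"
    unfolding nn_integral_indicator[OF m, symmetric]
    by (rule nn_integral_cong) (simp add: indicator_def)
  also have "\<dots> = (\<integral>\<^sup>+\<omega>. \<integral>\<^sup>+r. ?K (sample_path \<omega>, r) \<partial>lborel \<partial>P)"
    by (simp add: nn_integral_cmult)
  also have "\<dots> = (\<integral>\<^sup>+\<omega>. \<integral>\<^sup>+r. ?K (recentre r (sample_path \<omega>), r) \<partial>lborel \<partial>P)"
    by (rule nn_integral_stationary_lborel[OF K])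
  also have "\<dots> = (\<integral>\<^sup>+\<omega>. 0 \<partial>P)"
  proof (rule nn_integral_cong_AE)
    show "AE \<omega> in P. (\<integral>\<^sup>+r. ?K (recentre r (sample_path \<omega>), r) \<partial>lborel) = 0"
      using cnt AE_space
    proof eventually_elim
      case (elim \<omega>)
      have "AE r in lborel. r \<notin> contact_set \<alpha> (sample_path \<omega>)"
        by (rule AE_not_in[OF countable_imp_null_set_lborel[OF elim(1)]])
      then have "AE r in lborel. ?K (recentre r (sample_path \<omega>), r) = 0"
      proof eventually_elim
        case (elim r)
        then have "recentre r (sample_path \<omega>) \<notin> B"
          using contact_set_sample_path_recentre[OF \<alpha> \<open>\<omega> \<in> space P\<close>, of r]
          by (auto simp: B_iff[OF cadlag_recentre[OF cadlag_paths[OF \<open>\<omega> \<in> space P\<close>]]])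
        then show ?case by simp
      qed
      then have "(\<integral>\<^sup>+r. ?K (recentre r (sample_path \<omega>), r) \<partial>lborel) = (\<integral>\<^sup>+r. 0 \<partial>(lborel :: real measure))"
        by (rule nn_integral_cong_AE)
      then show ?case by simp
    qed
  qed
  finally have "emeasure P {\<omega> \<in> space P. sample_path \<omega> \<in> B} = 0" by simp
  then have "AE \<omega> in P. sample_path \<omega> \<notin> B"
    using AE_iff_measurable[OF m, of "\<lambda>\<omega>. sample_path \<omega> \<notin> B"] by simp
  then show ?thesis
    using AE_space by eventually_elim (simp add: B_iff[OF cadlag_paths])
qed

text \<open>Both sides are the expectation of an integral over \<open>r\<close>: on the left, of the mass density that the
  origin sends to \<open>-r\<close>, and on the right, of the density that \<open>r\<close> sends to the origin. The second is the
  first for the path recentred at \<open>r\<close>.\<close>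

lemma gap_mass_transport:
  assumes \<alpha>: "0 < \<alpha>" and cnt: "AE \<omega> in P. countable (contact_set \<alpha> (sample_path \<omega>))"
    and unb: "AE \<omega> in P. \<forall>s. contact_set \<alpha> (sample_path \<omega>) \<inter> {..<s} \<noteq> {} \<and> contact_set \<alpha> (sample_path \<omega>) \<inter> {s<..} \<noteq> {}"
    and h: "h \<in> borel_measurable path_space"
  shows "(\<integral>\<^sup>+\<omega>. h (sample_path \<omega>) \<partial>P) =
    (\<integral>\<^sup>+\<omega>. \<integral>\<^sup>+r. indicator {last_contact \<alpha> (sample_path \<omega>)<..<next_contact \<alpha> (sample_path \<omega>)} r *
      (h (recentre r (sample_path \<omega>)) / ennreal (next_contact \<alpha> (sample_path \<omega>) - last_contact \<alpha> (sample_path \<omega>))) \<partial>lborel \<partial>P)"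
proof -
  note [measurable] = measurable_last_contact[OF \<alpha>] measurable_next_contact[OF \<alpha>] h
  \<comment> \<open>The mass density sent from the origin to \<open>- snd p\<close>.\<close>
  define K where "K p = (if - next_contact \<alpha> (fst p) < snd p \<and> snd p < - last_contact \<alpha> (fst p)
    then h (fst p) / ennreal (next_contact \<alpha> (fst p) - last_contact \<alpha> (fst p)) else 0)"
    for p :: "(real \<Rightarrow> real) \<times> real"
  have K: "K \<in> borel_measurable (path_space \<Otimes>\<^sub>M lborel)"
    unfolding K_def[abs_def] by measurable
  note good = cnt unb zero_not_contact_AE[OF \<alpha> cnt] AE_space
  have "(\<integral>\<^sup>+\<omega>. h (sample_path \<omega>) \<partial>P) = (\<integral>\<^sup>+\<omega>. \<integral>\<^sup>+r. K (sample_path \<omega>, r) \<partial>lborel \<partial>P)"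
  proof (rule nn_integral_cong_AE)
    show "AE \<omega> in P. h (sample_path \<omega>) = (\<integral>\<^sup>+r. K (sample_path \<omega>, r) \<partial>lborel)"
      using good
    proof eventually_elim
      case (elim \<omega>)
      let ?g = "last_contact \<alpha> (sample_path \<omega>)" and ?d = "next_contact \<alpha> (sample_path \<omega>)"
      have gd: "?g < 0" "0 < ?d"
        using contact_gap(3,4)[OF \<alpha> cadlag_paths[OF elim(4)] elim(3) elim(3)] elim(2) by blast+
      have "(\<integral>\<^sup>+r. K (sample_path \<omega>, r) \<partial>lborel) =
          (\<integral>\<^sup>+r. h (sample_path \<omega>) / ennreal (?d - ?g) * indicator {- ?d<..<- ?g} r \<partial>lborel)"
        by (rule nn_integral_cong) (simp add: K_def indicator_def)
      also have "\<dots> = h (sample_path \<omega>) / ennreal (?d - ?g) * ennreal (?d - ?g)"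
        using gd by (simp add: nn_integral_cmult_indicator)
      also have "\<dots> = h (sample_path \<omega>)"
        using ennreal_mult_divide_cancel[of "?d - ?g"] gd by (simp add: mult.commute)
      finally show ?case by simp
    qed
  qed
  also have "\<dots> = (\<integral>\<^sup>+\<omega>. \<integral>\<^sup>+r. K (recentre r (sample_path \<omega>), r) \<partial>lborel \<partial>P)"
    by (rule nn_integral_stationary_lborel[OF K])
  also have "\<dots> = (\<integral>\<^sup>+\<omega>. \<integral>\<^sup>+r. indicator {last_contact \<alpha> (sample_path \<omega>)<..<next_contact \<alpha> (sample_path \<omega>)} r *
      (h (recentre r (sample_path \<omega>)) / ennreal (next_contact \<alpha> (sample_path \<omega>) - last_contact \<alpha> (sample_path \<omega>))) \<partial>lborel \<partial>P)"
  proof (rule nn_integral_cong_AE)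
    show "AE \<omega> in P. (\<integral>\<^sup>+r. K (recentre r (sample_path \<omega>), r) \<partial>lborel) =
      (\<integral>\<^sup>+r. indicator {last_contact \<alpha> (sample_path \<omega>)<..<next_contact \<alpha> (sample_path \<omega>)} r *
      (h (recentre r (sample_path \<omega>)) / ennreal (next_contact \<alpha> (sample_path \<omega>) - last_contact \<alpha> (sample_path \<omega>))) \<partial>lborel)"
      using good
    proof eventually_elim
      case (elim \<omega>)
      have "AE r in lborel. r \<notin> contact_set \<alpha> (sample_path \<omega>)"
        by (rule AE_not_in[OF countable_imp_null_set_lborel[OF elim(1)]])
      then show ?case
      proof (intro nn_integral_cong_AE, eventually_elim)
        fix r assume r: "r \<notin> contact_set \<alpha> (sample_path \<omega>)"
        have unb': "contact_set \<alpha> (sample_path \<omega>) \<inter> {..<s} \<noteq> {}" "contact_set \<alpha> (sample_path \<omega>) \<inter> {s<..} \<noteq> {}" for s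
          using elim(2) by blast+
        note gap = contact_gap(1,2)[OF \<alpha> cadlag_paths[OF elim(4)] elim(3) r unb']
        have "- next_contact \<alpha> (recentre r (sample_path \<omega>)) < r \<and> r < - last_contact \<alpha> (recentre r (sample_path \<omega>)) \<longleftrightarrow>
            last_contact \<alpha> (sample_path \<omega>) < r \<and> r < next_contact \<alpha> (sample_path \<omega>)"
          using gap(1) by auto
        then show "K (recentre r (sample_path \<omega>), r) =
            indicator {last_contact \<alpha> (sample_path \<omega>)<..<next_contact \<alpha> (sample_path \<omega>)} r *
            (h (recentre r (sample_path \<omega>)) / ennreal (next_contact \<alpha> (sample_path \<omega>) - last_contact \<alpha> (sample_path \<omega>)))"
          using gap(2) by (auto simp: K_def indicator_def)
      qed
    qed
  qed
  finally show ?thesis .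
qed

text \<open>Within the gap the path recentred at \<open>r\<close> has the same \<open>\<Psi>\<close> as the path itself, while the origin sits
  at the fraction \<open>(r - g) / (d - g)\<close>, which runs linearly from \<open>0\<close> to \<open>1\<close>.\<close>

lemma gap_fraction_uniform:
  assumes \<alpha>: "0 < \<alpha>" and cnt: "AE \<omega> in P. countable (contact_set \<alpha> (sample_path \<omega>))"
    and unb: "AE \<omega> in P. \<forall>s. contact_set \<alpha> (sample_path \<omega>) \<inter> {..<s} \<noteq> {} \<and> contact_set \<alpha> (sample_path \<omega>) \<inter> {s<..} \<noteq> {}"
    and \<Psi>: "\<Psi> \<in> path_space \<rightarrow>\<^sub>M N"
    and invariant: "\<And>f r. last_contact \<alpha> (recentre r f) = last_contact \<alpha> f - r \<Longrightarrow>
      next_contact \<alpha> (recentre r f) = next_contact \<alpha> f - r \<Longrightarrow> \<Psi> (recentre r f) = \<Psi> f"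
    and A: "A \<in> sets borel" and B: "B \<in> sets N"
  shows "emeasure P {\<omega> \<in> space P. - last_contact \<alpha> (sample_path \<omega>) / (next_contact \<alpha> (sample_path \<omega>) - last_contact \<alpha> (sample_path \<omega>)) \<in> A \<and>
      \<Psi> (sample_path \<omega>) \<in> B} =
    emeasure lborel (A \<inter> {0<..<1}) * emeasure P {\<omega> \<in> space P. \<Psi> (sample_path \<omega>) \<in> B}"
proof -
  note [measurable] = measurable_last_contact[OF \<alpha>] measurable_next_contact[OF \<alpha>] \<Psi> A B
  define U where "U f = - last_contact \<alpha> f / (next_contact \<alpha> f - last_contact \<alpha> f)" for f
  have [measurable]: "U \<in> borel_measurable path_space" unfolding U_def[abs_def] by measurable
  define h :: "(real \<Rightarrow> real) \<Rightarrow> ennreal" where "h f = indicator A (U f) * indicator B (\<Psi> f)" for f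
  have h: "h \<in> borel_measurable path_space" unfolding h_def[abs_def] by measurable
  have UB: "{\<omega> \<in> space P. U (sample_path \<omega>) \<in> A \<and> \<Psi> (sample_path \<omega>) \<in> B} \<in> events" by measurable
  have \<Psi>B: "{\<omega> \<in> space P. \<Psi> (sample_path \<omega>) \<in> B} \<in> events" by measurable
  have "emeasure P {\<omega> \<in> space P. U (sample_path \<omega>) \<in> A \<and> \<Psi> (sample_path \<omega>) \<in> B} = (\<integral>\<^sup>+\<omega>. h (sample_path \<omega>) \<partial>P)"
    unfolding nn_integral_indicator[OF UB, symmetric]
    by (rule nn_integral_cong) (simp add: h_def indicator_def)
  also have "\<dots> = (\<integral>\<^sup>+\<omega>. \<integral>\<^sup>+r. indicator {last_contact \<alpha> (sample_path \<omega>)<..<next_contact \<alpha> (sample_path \<omega>)} r *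
      (h (recentre r (sample_path \<omega>)) / ennreal (next_contact \<alpha> (sample_path \<omega>) - last_contact \<alpha> (sample_path \<omega>))) \<partial>lborel \<partial>P)"
    by (rule gap_mass_transport[OF \<alpha> cnt unb h])
  also have "\<dots> = (\<integral>\<^sup>+\<omega>. emeasure lborel (A \<inter> {0<..<1}) * indicator B (\<Psi> (sample_path \<omega>)) \<partial>P)"
  proof (rule nn_integral_cong_AE)
    show "AE \<omega> in P. (\<integral>\<^sup>+r. indicator {last_contact \<alpha> (sample_path \<omega>)<..<next_contact \<alpha> (sample_path \<omega>)} r *
      (h (recentre r (sample_path \<omega>)) / ennreal (next_contact \<alpha> (sample_path \<omega>) - last_contact \<alpha> (sample_path \<omega>))) \<partial>lborel) =
      emeasure lborel (A \<inter> {0<..<1}) * indicator B (\<Psi> (sample_path \<omega>))"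
      using cnt unb zero_not_contact_AE[OF \<alpha> cnt] AE_space
    proof eventually_elim
      case (elim \<omega>)
      let ?g = "last_contact \<alpha> (sample_path \<omega>)" and ?d = "next_contact \<alpha> (sample_path \<omega>)"
      let ?c = "indicator B (\<Psi> (sample_path \<omega>)) :: ennreal"
      have unb': "contact_set \<alpha> (sample_path \<omega>) \<inter> {..<s} \<noteq> {}" "contact_set \<alpha> (sample_path \<omega>) \<inter> {s<..} \<noteq> {}" for s
        using elim(2) by blast+
      note gap = contact_gap(2-4)[OF \<alpha> cadlag_paths[OF elim(4)] elim(3) _ unb']
      have gd: "?g < ?d" using gap(2,3)[OF elim(3)] by simp
      have "AE r in lborel. r \<notin> contact_set \<alpha> (sample_path \<omega>)"
        by (rule AE_not_in[OF countable_imp_null_set_lborel[OF elim(1)]])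
      then have "(\<integral>\<^sup>+r. indicator {?g<..<?d} r * (h (recentre r (sample_path \<omega>)) / ennreal (?d - ?g)) \<partial>lborel) =
        (\<integral>\<^sup>+r. indicator {?g<..<?d} r * indicator A ((r - ?g) / (?d - ?g)) * (?c / ennreal (?d - ?g)) \<partial>lborel)"
      proof (intro nn_integral_cong_AE, eventually_elim)
        fix r assume r: "r \<notin> contact_set \<alpha> (sample_path \<omega>)"
        show "indicator {?g<..<?d} r * (h (recentre r (sample_path \<omega>)) / ennreal (?d - ?g)) =
          indicator {?g<..<?d} r * indicator A ((r - ?g) / (?d - ?g)) * (?c / ennreal (?d - ?g))"
        proof (cases "r \<in> {?g<..<?d}")
          case True
          with gap(1)[OF r] have eq: "last_contact \<alpha> (recentre r (sample_path \<omega>)) = ?g - r"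
            "next_contact \<alpha> (recentre r (sample_path \<omega>)) = ?d - r" by auto
          have "U (recentre r (sample_path \<omega>)) = (r - ?g) / (?d - ?g)" by (simp add: U_def eq)
          moreover have "\<Psi> (recentre r (sample_path \<omega>)) = \<Psi> (sample_path \<omega>)" by (rule invariant) (simp_all add: eq)
          ultimately show ?thesis by (simp add: h_def ennreal_times_divide mult.assoc)
        qed simp
      qed
      also have "\<dots> = (\<integral>\<^sup>+r. indicator {?g<..<?d} r * indicator A ((r - ?g) / (?d - ?g)) \<partial>lborel) *
          (?c / ennreal (?d - ?g))"
        by (rule nn_integral_multc) measurable
      also have "\<dots> = emeasure lborel (A \<inter> {0<..<1}) * (ennreal (?d - ?g) * (?c / ennreal (?d - ?g)))"
        by (simp add: nn_integral_gap_fraction[OF gd A] mult_ac)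
      also have "\<dots> = emeasure lborel (A \<inter> {0<..<1}) * ?c"
        using gd by (subst ennreal_mult_divide_cancel) auto
      finally show ?case .
    qed
  qed
  also have "\<dots> = emeasure lborel (A \<inter> {0<..<1}) * (\<integral>\<^sup>+\<omega>. indicator B (\<Psi> (sample_path \<omega>)) \<partial>P)"
    by (rule nn_integral_cmult) measurable
  also have "(\<integral>\<^sup>+\<omega>. indicator B (\<Psi> (sample_path \<omega>)) \<partial>P) = emeasure P {\<omega> \<in> space P. \<Psi> (sample_path \<omega>) \<in> B}"
    unfolding nn_integral_indicator[OF \<Psi>B, symmetric]
    by (rule nn_integral_cong) (simp add: indicator_def)
  finally show ?thesis by (simp add: U_def)
qed

end

section \<open>The position of the origin in its gap\<close>

lemma emeasure_unit_interval_reflect: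
  assumes [measurable]: "A \<in> sets borel"
  shows "emeasure lborel ({x. 1 - x \<in> A} \<inter> {0<..<1 :: real}) = emeasure lborel (A \<inter> {0<..<1})"
proof -
  have [measurable]: "{x. 1 - x \<in> A} \<in> sets borel"
    using measurable_sets[of "\<lambda>x. 1 - x" borel borel A] by (simp add: vimage_def)
  have "emeasure lborel (A \<inter> {0<..<1}) = (\<integral>\<^sup>+x. indicator (A \<inter> {0<..<1}) x \<partial>lborel)" by simp
  also have "\<dots> = ennreal \<bar>- 1\<bar> * (\<integral>\<^sup>+x. indicator (A \<inter> {0<..<1}) (1 + - 1 * x) \<partial>lborel)"
    by (rule nn_integral_real_affine) simp_all
  also have "\<dots> = (\<integral>\<^sup>+x. indicator ({x. 1 - x \<in> A} \<inter> {0<..<1}) x \<partial>lborel)"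
    by (auto intro!: nn_integral_cong simp: indicator_def)
  finally show ?thesis by simp
qed

lemma (in prob_space) indep_rvsI:
  assumes "random_variable S U" "random_variable T V"
    and "\<And>A B. A \<in> sets S \<Longrightarrow> B \<in> sets T \<Longrightarrow>
      prob {\<omega> \<in> space M. U \<omega> \<in> A \<and> V \<omega> \<in> B} = prob {\<omega> \<in> space M. U \<omega> \<in> A} * prob {\<omega> \<in> space M. V \<omega> \<in> B}"
  shows "indep_rvs S U T V"
  unfolding indep_rvs_def
proof (intro conjI assms(1,2) indep_set_sigma_sets indep_setI)
  show "{U -` A \<inter> space M |A. A \<in> sets S} \<subseteq> events" "{V -` A \<inter> space M |A. A \<in> sets T} \<subseteq> events"
    using assms(1,2) by (auto intro: measurable_sets)
  show "Int_stable {U -` A \<inter> space M |A. A \<in> sets S}"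
  proof (rule Int_stableI, safe)
    fix A B assume "A \<in> sets S" "B \<in> sets S"
    then show "\<exists>C. U -` A \<inter> space M \<inter> (U -` B \<inter> space M) = U -` C \<inter> space M \<and> C \<in> sets S"
      by (intro exI[of _ "A \<inter> B"]) auto
  qed
  show "Int_stable {V -` A \<inter> space M |A. A \<in> sets T}"
  proof (rule Int_stableI, safe)
    fix A B assume "A \<in> sets T" "B \<in> sets T"
    then show "\<exists>C. V -` A \<inter> space M \<inter> (V -` B \<inter> space M) = V -` C \<inter> space M \<and> C \<in> sets T"
      by (intro exI[of _ "A \<inter> B"]) auto
  qed
  fix a b assume "a \<in> {U -` A \<inter> space M |A. A \<in> sets S}" "b \<in> {V -` A \<inter> space M |A. A \<in> sets T}"
  then obtain A B where AB: "A \<in> sets S" "B \<in> sets T" "a = U -` A \<inter> space M" "b = V -` B \<inter> space M" by auto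
  have "a \<inter> b = {\<omega> \<in> space M. U \<omega> \<in> A \<and> V \<omega> \<in> B}" "a = {\<omega> \<in> space M. U \<omega> \<in> A}" "b = {\<omega> \<in> space M. V \<omega> \<in> B}"
    unfolding AB by auto
  with assms(3)[OF AB(1,2)] show "prob (a \<inter> b) = prob a * prob b" by simp
qed

text \<open>The interval \<open>I\<close> may or may not contain its end points, so that one law serves for both
  \<open>[0, 1)\<close> and \<open>[0, 1]\<close>.\<close>

lemma (in prob_space) uniform_and_independentI:
  assumes U [measurable]: "U \<in> borel_measurable M" and V [measurable]: "V \<in> M \<rightarrow>\<^sub>M N"
    and I: "I \<in> sets borel" "{0<..<1 :: real} \<subseteq> I" "I \<subseteq> {0..1}"
    and law: "\<And>A B. A \<in> sets borel \<Longrightarrow> B \<in> sets N \<Longrightarrow>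
      emeasure M {\<omega> \<in> space M. U \<omega> \<in> A \<and> V \<omega> \<in> B} =
      emeasure lborel (A \<inter> {0<..<1}) * emeasure M {\<omega> \<in> space M. V \<omega> \<in> B}"
  shows "distr M borel U = uniform_measure lborel I" and "indep_rvs borel U N V"
proof -
  have "{\<omega> \<in> space M. V \<omega> \<in> space N} = space M" using measurable_space[OF V] by auto
  then have U_law: "emeasure M {\<omega> \<in> space M. U \<omega> \<in> A} = emeasure lborel (A \<inter> {0<..<1})" if "A \<in> sets borel" for A
    using law[OF that sets.top] measurable_space[OF V] by (simp add: emeasure_space_1 cong: conj_cong)
  have I_Int: "emeasure lborel (I \<inter> A) = emeasure lborel (A \<inter> {0<..<1})" if "A \<in> sets borel" for A
  proof (rule emeasure_eq_AE)
    show "AE x in lborel. x \<in> I \<inter> A \<longleftrightarrow> x \<in> A \<inter> {0<..<1}"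
      using AE_lborel_singleton[of 0] AE_lborel_singleton[of 1]
    proof eventually_elim
      case (elim x)
      have "x \<in> {0..1} \<longleftrightarrow> x \<in> {0<..<1}" using elim by auto
      then have "x \<in> I \<longleftrightarrow> x \<in> {0<..<1}" using I(2,3) by blast
      then show ?case by blast
    qed
    show "I \<inter> A \<in> sets lborel" "A \<inter> {0<..<1} \<in> sets lborel" using I(1) that by simp_all
  qed
  have I_one: "emeasure lborel I = 1" using I_Int[of UNIV] by simp
  show "distr M borel U = uniform_measure lborel I"
  proof (intro measure_eqI)
    fix A assume "A \<in> sets (distr M borel U)"
    then have A: "A \<in> sets borel" by simp
    have "U -` A \<inter> space M = {\<omega> \<in> space M. U \<omega> \<in> A}" by auto
    then have "emeasure (distr M borel U) A = emeasure lborel (A \<inter> {0<..<1})"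
      by (simp add: emeasure_distr A U_law)
    also have "\<dots> = emeasure (uniform_measure lborel I) A"
      using A I(1) I_Int[OF A] I_one ennreal_mult_divide_cancel[of 1 "emeasure lborel (A \<inter> {0<..<1})"]
      by simp
    finally show "emeasure (distr M borel U) A = emeasure (uniform_measure lborel I) A" .
  qed simp
  show "indep_rvs borel U N V"
  proof (rule indep_rvsI[OF U V])
    fix A :: "real set" and B assume AB: "A \<in> sets borel" "B \<in> sets N"
    show "prob {\<omega> \<in> space M. U \<omega> \<in> A \<and> V \<omega> \<in> B} = prob {\<omega> \<in> space M. U \<omega> \<in> A} * prob {\<omega> \<in> space M. V \<omega> \<in> B}"
      using law[OF AB] U_law[OF AB(1)] by (simp add: measure_def enn2real_mult)
  qed
qed

theorem mainTheorem4:
  fixes P :: "'a measure" and X :: "real \<Rightarrow> 'a \<Rightarrow> real" and \<alpha> :: real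
    and Z :: "'a \<Rightarrow> real set" and G D :: "'a \<Rightarrow> real"
  assumes "\<alpha> > 0"
    and "two_sided_levy P X"
    and not_linear_drift: "\<not> (\<exists>a. AE \<omega> in P. \<forall>t. X t \<omega> = a * t)"
    and "integrable P (X 1)"
    and "\<bar>integral\<^sup>L P (X 1)\<bar> < \<alpha>"
    and Z_eq: "\<And>\<omega>. Z \<omega> = contact_set \<alpha> (\<lambda>t. X t \<omega>)"
    and "AE \<omega> in P. topological_space_class.discrete (Z \<omega>)"
    and G_eq: "\<And>\<omega>. G \<omega> = Sup (Z \<omega> \<inter> {..<0})"
    and D_eq: "\<And>\<omega>. D \<omega> = Inf (Z \<omega> \<inter> {0<..})"
  shows "distr P borel (\<lambda>\<omega>. - G \<omega> / (D \<omega> - G \<omega>)) = uniform_measure lborel {0..<1} \<and>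
    prob_space.indep_rvs P
      borel (\<lambda>\<omega>. - G \<omega> / (D \<omega> - G \<omega>))
      (\<Pi>\<^sub>M t\<in>UNIV. borel) (\<lambda>\<omega> t. X (t + D \<omega>) \<omega> - X (D \<omega>) \<omega>) \<and>
    distr P borel (\<lambda>\<omega>. D \<omega> / (D \<omega> - G \<omega>)) = uniform_measure lborel {0..1} \<and>
    prob_space.indep_rvs P
      borel (\<lambda>\<omega>. D \<omega> / (D \<omega> - G \<omega>))
      (borel \<Otimes>\<^sub>M (\<Pi>\<^sub>M s\<in>UNIV. borel)) (\<lambda>\<omega>. excursion (\<lambda>t. X t \<omega>) (G \<omega>) (D \<omega>))"
proof -
  interpret two_sided_levy P X by fact
  note \<alpha> = \<open>\<alpha> > 0\<close>
  have G: "G \<omega> = last_contact \<alpha> (sample_path \<omega>)" and D: "D \<omega> = next_contact \<alpha> (sample_path \<omega>)" for \<omega>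
    by (simp_all add: G_eq D_eq Z_eq last_contact_def next_contact_def)
  have GD_meas [measurable]: "G \<in> borel_measurable P" "D \<in> borel_measurable P"
    unfolding G[abs_def] D[abs_def]
    by (rule measurable_compose[OF measurable_sample_path measurable_last_contact[OF \<alpha>]]
        measurable_compose[OF measurable_sample_path measurable_next_contact[OF \<alpha>]])+
  have cnt: "AE \<omega> in P. countable (contact_set \<alpha> (sample_path \<omega>))"
    using \<open>AE \<omega> in P. topological_space_class.discrete (Z \<omega>)\<close>
    by eventually_elim (simp add: Z_eq discrete_imp_countable)
  have unb: "AE \<omega> in P. \<forall>s. contact_set \<alpha> (sample_path \<omega>) \<inter> {..<s} \<noteq> {} \<and> contact_set \<alpha> (sample_path \<omega>) \<inter> {s<..} \<noteq> {}"
    by (rule contact_set_unbounded_AE[OF \<alpha> contact_set_nonempty_AE[OF \<alpha>]]) fact+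
  have GD: "AE \<omega> in P. G \<omega> < D \<omega>"
    using unb zero_not_contact_AE[OF \<alpha> cnt] AE_space
  proof eventually_elim
    case (elim \<omega>)
    then have "last_contact \<alpha> (sample_path \<omega>) < 0" "0 < next_contact \<alpha> (sample_path \<omega>)"
      using contact_gap(3,4)[OF \<alpha> cadlag_paths[OF elim(3)] elim(2) elim(2)] by blast+
    then show ?case by (simp add: G D)
  qed
  let ?U = "\<lambda>\<omega>. - G \<omega> / (D \<omega> - G \<omega>)" and ?V = "\<lambda>\<omega>. D \<omega> / (D \<omega> - G \<omega>)"
  let ?\<Psi> = "\<lambda>f. recentre (next_contact \<alpha> f) f"
  let ?\<Phi> = "\<lambda>f. excursion f (last_contact \<alpha> f) (next_contact \<alpha> f)"
  have \<Psi>_path: "(\<lambda>\<omega> t. X (t + D \<omega>) \<omega> - X (D \<omega>) \<omega>) = (\<lambda>\<omega>. ?\<Psi> (sample_path \<omega>))"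
    by (simp add: recentre_def D)
  have \<Phi>_path: "(\<lambda>\<omega>. excursion (sample_path \<omega>) (G \<omega>) (D \<omega>)) = (\<lambda>\<omega>. ?\<Phi> (sample_path \<omega>))"
    by (simp add: G D)
  have UV_meas: "?U \<in> borel_measurable P" "?V \<in> borel_measurable P" by measurable
  have U_law: "emeasure P {\<omega> \<in> space P. ?U \<omega> \<in> A \<and> ?\<Psi> (sample_path \<omega>) \<in> B} =
      emeasure lborel (A \<inter> {0<..<1}) * emeasure P {\<omega> \<in> space P. ?\<Psi> (sample_path \<omega>) \<in> B}"
    if "A \<in> sets borel" "B \<in> sets (\<Pi>\<^sub>M t\<in>UNIV. borel)" for A B
    unfolding G D
    by (rule gap_fraction_uniform[OF \<alpha> cnt unb measurable_recentred_at_next[OF \<alpha>] _ that])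
      (simp add: recentre_recentre)
  have V_law: "emeasure P {\<omega> \<in> space P. ?V \<omega> \<in> A \<and> ?\<Phi> (sample_path \<omega>) \<in> B} =
      emeasure lborel (A \<inter> {0<..<1}) * emeasure P {\<omega> \<in> space P. ?\<Phi> (sample_path \<omega>) \<in> B}"
    if A: "A \<in> sets borel" and B: "B \<in> sets (borel \<Otimes>\<^sub>M (\<Pi>\<^sub>M s\<in>UNIV. borel))" for A B
  proof -
    note [measurable] = A B measurable_compose[OF measurable_sample_path measurable_straddling_excursion[OF \<alpha>]]
    have A': "{x. 1 - x \<in> A} \<in> sets borel"
      using measurable_sets[of "\<lambda>x. 1 - x" borel borel A] by (simp add: vimage_def)
    have "emeasure P {\<omega> \<in> space P. ?V \<omega> \<in> A \<and> ?\<Phi> (sample_path \<omega>) \<in> B} =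
        emeasure P {\<omega> \<in> space P. ?U \<omega> \<in> {x. 1 - x \<in> A} \<and> ?\<Phi> (sample_path \<omega>) \<in> B}"
    proof (rule emeasure_eq_AE)
      show "AE \<omega> in P. \<omega> \<in> {\<omega> \<in> space P. ?V \<omega> \<in> A \<and> ?\<Phi> (sample_path \<omega>) \<in> B} \<longleftrightarrow>
          \<omega> \<in> {\<omega> \<in> space P. ?U \<omega> \<in> {x. 1 - x \<in> A} \<and> ?\<Phi> (sample_path \<omega>) \<in> B}"
        using GD
      proof eventually_elim
        case (elim \<omega>)
        then have "1 - ?U \<omega> = ?V \<omega>" by (simp add: field_simps)
        then show ?case by simp
      qed
    qed measurable
    also have "\<dots> = emeasure lborel ({x. 1 - x \<in> A} \<inter> {0<..<1}) * emeasure P {\<omega> \<in> space P. ?\<Phi> (sample_path \<omega>) \<in> B}"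
      unfolding G D
      by (rule gap_fraction_uniform[OF \<alpha> cnt unb measurable_straddling_excursion[OF \<alpha>] _ A' B])
        (simp add: excursion_recentre)
    also have "emeasure lborel ({x. 1 - x \<in> A} \<inter> {0<..<1}) = emeasure lborel (A \<inter> {0<..<1})"
      by (rule emeasure_unit_interval_reflect[OF A])
    finally show ?thesis .
  qed
  note U = uniform_and_independentI[OF UV_meas(1)
      measurable_compose[OF measurable_sample_path measurable_recentred_at_next[OF \<alpha>]] _ _ _ U_law]
  note V = uniform_and_independentI[OF UV_meas(2)
      measurable_compose[OF measurable_sample_path measurable_straddling_excursion[OF \<alpha>]] _ _ _ V_law]
  have "distr P borel ?U = uniform_measure lborel {0..<1}"
    by (rule U(1)) auto
  moreover have "indep_rvs borel ?U (\<Pi>\<^sub>M t\<in>UNIV. borel) (\<lambda>\<omega>. ?\<Psi> (sample_path \<omega>))"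
    by (rule U(2)[of "{0<..<1}"]) auto
  moreover have "distr P borel ?V = uniform_measure lborel {0..1}"
    by (rule V(1)) auto
  moreover have "indep_rvs borel ?V (borel \<Otimes>\<^sub>M (\<Pi>\<^sub>M s\<in>UNIV. borel)) (\<lambda>\<omega>. ?\<Phi> (sample_path \<omega>))"
    by (rule V(2)[of "{0<..<1}"]) auto
  ultimately show ?thesis
    unfolding \<Psi>_path \<Phi>_path by blast
qed

end
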